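(* If $G$ is a cubic ribbon graph then $$\Omega(G;-2,1,0,1,3)=\#\{\text{proper edge 3-colourings of }G\}.$$
   Context: **Ribbon graphs.** A ribbon graph $G=(V(G),E(G))$ is a surface with boundary, represented as the union of two sets of discs, a set $V(G)$ of vertices and a set $E(G)$ of edges, such that: (1) the vertices and edges intersect in disjoint line segments; (2) each such line segment lies on the boundary of precisely one vertex and precisely one edge; (3) every edge contains exactly two such line segments. Equivalence is homeomorphism (orientation preserving when orientable) mapping vertices to vertices and edges to edges. A ribbon graph is cubic if every vertex has degree 3. A proper edge 3-colouring is a map from the edges to $\{1,2,3\}$ such that at every vertex the three incident edge-ends have pairwise distinct colours (so there are none if $G$ has a loop). Let $e\in E(G)$. *Deletion:* $G\setminus e$ is obtained by removing the edge $e$. *Contraction:* if $u,v$ are the (not necessarily distinct) vertices incident with $e$, consider the boundary component(s) of $e\cup\{u,v\}$ as curves on $G$; for each curve attach a disc (a new vertex) by identifying its boundary with the curve, and then delete $e,u,v$; the result is $G/e$. *Partial Petrial:* $G^{\tau(e)}$ is obtained by detaching one end of $e$ from its incident vertex $v$, creating arcs $[a,b]$ on $v$ and $[a',b']$ on $e$ (so that $G$ is recovered by identifying $[a,b]$ with $[a',b']$), and reattaching by identifying $[a,b]$ with $[b',a']$ (giving $e$ a half-twist). *Penrose-contraction:* $G\rightthreetimes e:=G^{\tau(e)}/e$. **Edge-point ribbon graphs.** An edge-point ribbon graph is an object obtained from a ribbon graph $(V,E)$ by contracting each edge (disc) in some (possibly empty) subset of $E$ to a point; the points so created are singular points and the images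 of the other edges are its edges. Equivalently, it is an edge 2-coloured ribbon graph in which dark grey edges represent those contracted to points and light grey edges are the edges of the edge-point ribbon graph (considered up to partial Petrials of dark grey edges). Ribbon graphs are the edge-point ribbon graphs with no singular points. Deletion, contraction and Penrose-contraction are inherited by performing the ribbon graph operations on light grey edges in the 2-coloured model. $G\odot e$ is obtained by contracting $e$ to a point (recolouring $e$ dark grey). **The polynomial $\Omega$.** $\Omega(G)=\Omega(G;w,x,y,z,t)\in\mathbb{Z}[w,x,y,z,t]$ is the polynomial of edge-point ribbon graphs defined by $\Omega(G)=w\,\Omega(G\odot e)+x\,\Omega(G/e)+y\,\Omega(G\setminus e)+z\,\Omega(G\rightthreetimes e)$ for any edge $e$, and $\Omega(G)=t^{\kappa(G)}$ if $G$ is edgeless, where $\kappa(G)$ is the number of connected components. *)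

theory Defs
  imports "HOL-Computational_Algebra.Polynomial" "HOL-Library.FuncSet"
begin

section \<open>Ribbon graphs\<close>

text \<open>
  A ribbon graph is encoded by the cell structure of its surface. Its \<^emph>\<open>corners\<close> are the
  end points of the line segments in which vertex discs and edge discs meet. These points
  cut all boundary circles of all discs into intervals, and each corner is an end point of exactly
  one interval of each of the following three kinds:

    \<^item> a common line segment of a vertex and an edge (an edge-end), joining \<open>f\<close> to \<open>seg f\<close>;
    \<^item> a side of an edge, i.e. a component of the rest of the boundary of the edge disc,
      joining \<open>f\<close> to \<open>side f\<close>;
    \<^item> an arc of a vertex, i.e. a component of the rest of the boundary of the vertex disc,
      joining \<open>f\<close> to \<open>arc f\<close>.

  The boundary circle of an edge therefore alternates between \<open>seg\<close> and \<open>side\<close>, and has exactly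
  four corners since an edge contains exactly two line segments. The boundary circle of a vertex
  alternates between \<open>seg\<close> and \<open>arc\<close>. Vertices that meet no edge have no corners; as ribbon graphs
  are considered up to homeomorphism, only their number \<open>isolated\<close> is recorded. Gluing discs along
  these circles recovers the surface, and homeomorphisms of ribbon graphs correspond to
  bijections of corners that commute with the three maps.
\<close>

record 'a ribbon =
  corners :: "'a set"
  seg :: "'a \<Rightarrow> 'a"
  side :: "'a \<Rightarrow> 'a"
  arc :: "'a \<Rightarrow> 'a"
  isolated :: nat

definition pairing_on :: "'a set \<Rightarrow> ('a \<Rightarrow> 'a) \<Rightarrow> bool" where
  "pairing_on A h \<longleftrightarrow> (\<forall>x\<in>A. h x \<in> A \<and> h (h x) = x \<and> h x \<noteq> x)"

definition ribbon_graph :: "('a, 'b) ribbon_scheme \<Rightarrow> bool" where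
  "ribbon_graph G \<longleftrightarrow> finite (corners G) \<and>
     pairing_on (corners G) (seg G) \<and>
     pairing_on (corners G) (side G) \<and>
     pairing_on (corners G) (arc G) \<and>
     (\<forall>f\<in>corners G. seg G (side G f) = side G (seg G f) \<and> seg G f \<noteq> side G f)"

definition conn :: "('a \<Rightarrow> 'a) set \<Rightarrow> 'a set \<Rightarrow> ('a \<times> 'a) set" where
  "conn hs A = {(x, h x) | x h. x \<in> A \<and> h \<in> hs}\<^sup>*"

definition orbits :: "('a \<Rightarrow> 'a) set \<Rightarrow> 'a set \<Rightarrow> 'a set set" where
  "orbits hs A = A // conn hs A"

text \<open>
  An edge is the set of its four corners, an edge-end is a pair of corners, and a non-isolated
  vertex is the set of the corners on its boundary.
\<close>

definition edges :: "('a, 'b) ribbon_scheme \<Rightarrow> 'a set set" where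
  "edges G = orbits {seg G, side G} (corners G)"

definition edge_ends :: "('a, 'b) ribbon_scheme \<Rightarrow> 'a set set" where
  "edge_ends G = orbits {seg G} (corners G)"

definition vertices :: "('a, 'b) ribbon_scheme \<Rightarrow> 'a set set" where
  "vertices G = orbits {seg G, arc G} (corners G)"

definition degree_of :: "('a, 'b) ribbon_scheme \<Rightarrow> 'a set \<Rightarrow> nat" where
  "degree_of G v = card {s \<in> edge_ends G. s \<subseteq> v}"

text \<open>Isolated vertices have degree 0.\<close>

definition cubic :: "('a, 'b) ribbon_scheme \<Rightarrow> bool" where
  "cubic G \<longleftrightarrow> isolated G = 0 \<and> (\<forall>v\<in>vertices G. degree_of G v = 3)"

definition proper_edge_3_colouring :: "('a, 'b) ribbon_scheme \<Rightarrow> ('a set \<Rightarrow> nat) \<Rightarrow> bool" where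
  "proper_edge_3_colouring G c \<longleftrightarrow> c \<in> edges G \<rightarrow>\<^sub>E {1, 2, 3} \<and>
     (\<forall>v\<in>vertices G. \<forall>s\<in>edge_ends G. \<forall>s'\<in>edge_ends G. s \<subseteq> v \<longrightarrow> s' \<subseteq> v \<longrightarrow> s \<noteq> s' \<longrightarrow>
       (\<forall>e\<in>edges G. \<forall>e'\<in>edges G. s \<subseteq> e \<longrightarrow> s' \<subseteq> e' \<longrightarrow> c e \<noteq> c e'))"

section \<open>Deletion, contraction and partial Petrials\<close>

text \<open>
  All edge removals have the same shape: consider the curves on \<open>G\<close> that run along the arcs of the
  vertices and cross the ends of all edges other than \<open>e\<close>, but that at \<open>e\<close> follow a
  pairing \<open>m\<close> of the four corners of \<open>e\<close>. They bound the new vertices, and \<open>e\<close> disappears.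
  For \<open>m = seg G\<close> these curves are the vertex boundaries of \<open>G\<close>, so this is deletion of \<open>e\<close>. For
  \<open>m = side G\<close> the boundaries of the vertices not incident with \<open>e\<close> are unchanged, and
  the other curves are the boundary components of the union of \<open>e\<close> and its incident vertices,
  so this is contraction.

  The new arc starting at a corner \<open>f\<close> outside \<open>e\<close> is obtained by following old arcs and \<open>m\<close> until a
  corner outside \<open>e\<close> is reached; as \<open>m\<close> has only two pairs, at most two passes through \<open>e\<close> occur.
  Curves all of whose corners belong to \<open>e\<close> become isolated vertices.
\<close>

definition remove_edge_along ::
    "('a \<Rightarrow> 'a) \<Rightarrow> 'a set \<Rightarrow> ('a, 'b) ribbon_scheme \<Rightarrow> ('a, 'b) ribbon_scheme" where
  "remove_edge_along m e G =
     (let hop = (\<lambda>f. if f \<in> e then arc G (m f) else f);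
          cross = (\<lambda>f. if f \<in> e then m f else seg G f)
      in G\<lparr>corners := corners G - e,
           arc := (\<lambda>f. hop (hop (arc G f))),
           isolated := isolated G + card {C \<in> orbits {cross, arc G} (corners G). C \<subseteq> e}\<rparr>)"

definition delete_edge :: "'a set \<Rightarrow> ('a, 'b) ribbon_scheme \<Rightarrow> ('a, 'b) ribbon_scheme" where
  "delete_edge e G = remove_edge_along (seg G) e G"

definition contract_edge :: "'a set \<Rightarrow> ('a, 'b) ribbon_scheme \<Rightarrow> ('a, 'b) ribbon_scheme" where
  "contract_edge e G = remove_edge_along (side G) e G"

text \<open>
  Reattaching one end \<open>{a, b}\<close> of \<open>e\<close> after a half-twist swaps the roles of \<open>a\<close> and \<open>b\<close> in the sides
  of \<open>e\<close>; the outcome is the same for both ends of \<open>e\<close>.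
\<close>

definition partial_petrial :: "'a set \<Rightarrow> ('a, 'b) ribbon_scheme \<Rightarrow> ('a, 'b) ribbon_scheme" where
  "partial_petrial e G = G\<lparr>side := (\<lambda>f. if f \<in> e then side G (seg G f) else side G f)\<rparr>"

definition penrose_contract_edge ::
    "'a set \<Rightarrow> ('a, 'b) ribbon_scheme \<Rightarrow> ('a, 'b) ribbon_scheme" where
  "penrose_contract_edge e G = contract_edge e (partial_petrial e G)"

section \<open>Edge-point ribbon graphs\<close>

text \<open>
  Edge-point ribbon graphs are given by edge 2-coloured ribbon graphs. The \<open>dark\<close> edges are those
  contracted to points. The operations above leave the field \<open>dark\<close> unchanged.
\<close>

record 'a edge_point_ribbon = "'a ribbon" +
  dark :: "'a set set"

definition edge_point_ribbon_graph :: "'a edge_point_ribbon \<Rightarrow> bool" where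
  "edge_point_ribbon_graph G \<longleftrightarrow> ribbon_graph G \<and> dark G \<subseteq> edges G"

definition light_edges :: "'a edge_point_ribbon \<Rightarrow> 'a set set" where
  "light_edges G = edges G - dark G"

definition edge_to_point :: "'a set \<Rightarrow> 'a edge_point_ribbon \<Rightarrow> 'a edge_point_ribbon" where
  "edge_to_point e G = G\<lparr>dark := insert e (dark G)\<rparr>"

text \<open>Contracting an edge to a point does not disconnect anything, so dark edges connect.\<close>

definition kappa :: "'a edge_point_ribbon \<Rightarrow> nat" where
  "kappa G = isolated G + card (orbits {seg G, side G, arc G} (corners G))"

definition as_edge_point :: "'a ribbon \<Rightarrow> 'a edge_point_ribbon" where
  "as_edge_point G = \<lparr>corners = corners G, seg = seg G, side = side G, arc = arc G,
     isolated = isolated G, dark = {}\<rparr>"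

section \<open>The polynomial Omega\<close>

text \<open>\<open>\<int>[w,x,y,z,t]\<close> is represented as \<open>\<int>[w][x][y][z][t]\<close>.\<close>

type_synonym poly_wxyzt = "int poly poly poly poly poly"

definition var_w :: poly_wxyzt where "var_w = [:[:[:[:[:0, 1:]:]:]:]:]"
definition var_x :: poly_wxyzt where "var_x = [:[:[:[:0, 1:]:]:]:]"
definition var_y :: poly_wxyzt where "var_y = [:[:[:0, 1:]:]:]"
definition var_z :: poly_wxyzt where "var_z = [:[:0, 1:]:]"
definition var_t :: poly_wxyzt where "var_t = [:0, 1:]"

definition eval_wxyzt :: "poly_wxyzt \<Rightarrow> int \<Rightarrow> int \<Rightarrow> int \<Rightarrow> int \<Rightarrow> int \<Rightarrow> int" where
  "eval_wxyzt p w x y z t =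
     poly (poly (poly (poly (poly p [:[:[:[:t:]:]:]:]) [:[:[:z:]:]:]) [:[:y:]:]) [:x:]) w"

text \<open>The value on objects that are not edge-point ribbon graphs is fixed to make Omega unique.\<close>

definition is_Omega :: "('a edge_point_ribbon \<Rightarrow> poly_wxyzt) \<Rightarrow> bool" where
  "is_Omega \<Phi> \<longleftrightarrow>
     (\<forall>G. edge_point_ribbon_graph G \<longrightarrow> (\<forall>e\<in>light_edges G.
        \<Phi> G = var_w * \<Phi> (edge_to_point e G) + var_x * \<Phi> (contract_edge e G)
            + var_y * \<Phi> (delete_edge e G) + var_z * \<Phi> (penrose_contract_edge e G))) \<and>
     (\<forall>G. edge_point_ribbon_graph G \<longrightarrow> light_edges G = {} \<longrightarrow> \<Phi> G = var_t ^ kappa G) \<and>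
     (\<forall>G. \<not> edge_point_ribbon_graph G \<longrightarrow> \<Phi> G = 0)"

definition Omega :: "'a edge_point_ribbon \<Rightarrow> poly_wxyzt" where
  "Omega = (THE \<Phi>. is_Omega \<Phi>)"

section \<open>Existence and uniqueness of Omega\<close>

subsection \<open>Counting components\<close>

lemma rtrancl_sym: "sym R \<Longrightarrow> (x, y) \<in> R\<^sup>* \<Longrightarrow> (y, x) \<in> R\<^sup>*"
  using sym_rtrancl symD by metis

lemma rtrancl_closed:
  assumes "(x, y) \<in> R\<^sup>*" "x \<in> A" "\<And>u v. u \<in> A \<Longrightarrow> (u, v) \<in> R \<Longrightarrow> v \<in> A"
  shows "y \<in> A"
  using assms(1,2) by (induction) (auto intro: assms(3))

lemma rtrancl_agree:
  assumes "\<And>u. (x, u) \<in> R\<^sup>* \<Longrightarrow> u \<in> e"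
    and "\<And>u v. u \<in> e \<Longrightarrow> (u, v) \<in> R \<Longrightarrow> (u, v) \<in> S"
    and "(x, y) \<in> R\<^sup>*"
  shows "(x, y) \<in> S\<^sup>*"
  using assms(3)
proof (induction)
  case (step u v)
  then show ?case using assms(1,2) by (blast intro: rtrancl.rtrancl_into_rtrancl)
qed simp

lemma trapped_classes:
  assumes "\<And>u v. u \<in> e \<Longrightarrow> (u, v) \<in> R \<longleftrightarrow> (u, v) \<in> S"
  shows "{C \<in> F // R\<^sup>*. C \<subseteq> e} = {C \<in> F // S\<^sup>*. C \<subseteq> e}"
proof -
  have *: "C \<in> F // S\<^sup>*" if C: "C \<in> F // R\<^sup>*" and "C \<subseteq> e"
    and eq: "\<And>u v. u \<in> e \<Longrightarrow> (u, v) \<in> R \<longleftrightarrow> (u, v) \<in> S" for C and R S :: "('a \<times> 'a) set"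
  proof -
    obtain x where x: "x \<in> F" "C = R\<^sup>* `` {x}" using C by (rule quotientE)
    have R_in: "u \<in> e" if "(x, u) \<in> R\<^sup>*" for u using that x(2) \<open>C \<subseteq> e\<close> by auto
    have 1: "(x, u) \<in> S\<^sup>*" if "(x, u) \<in> R\<^sup>*" for u
      using rtrancl_agree[of x R e S u] R_in eq that by blast
    have 2: "(x, u) \<in> R\<^sup>*" if "(x, u) \<in> S\<^sup>*" for u
      using that
    proof (induction)
      case (step u v)
      then show ?case using R_in eq by (blast intro: rtrancl.rtrancl_into_rtrancl)
    qed simp
    have "C = S\<^sup>* `` {x}" using x(2) 1 2 by auto
    then show ?thesis using x(1) by (auto intro: quotientI)
  qed
  show ?thesis using *[of _ R S] *[of _ S R] assms by blast
qed

definition graph_on :: "'a set \<Rightarrow> ('a \<Rightarrow> 'a) \<Rightarrow> ('a \<times> 'a) set" where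
  "graph_on A h = {(x, h x) | x. x \<in> A}"

lemma graph_on_iff: "(x, y) \<in> graph_on A h \<longleftrightarrow> x \<in> A \<and> y = h x"
  by (auto simp: graph_on_def)

lemma sym_graph_on: "pairing_on A h \<Longrightarrow> sym (graph_on A h)"
  by (auto simp: sym_def graph_on_def pairing_on_def)

lemma four_elements:
  assumes "card e = 4" "g1 \<in> e" "g2 \<in> e" "g3 \<in> e" "g4 \<in> e" "distinct [g1, g2, g3, g4]"
  shows "e = {g1, g2, g3, g4}"
proof -
  have "finite e" using assms(1) card.infinite by fastforce
  moreover have "card {g1, g2, g3, g4} = 4" using assms(6) by simp
  ultimately show ?thesis
    using card_subset_eq[of e "{g1, g2, g3, g4}"] assms by auto
qed

definition splice_hop :: "'a set \<Rightarrow> ('a \<Rightarrow> 'a) \<Rightarrow> ('a \<Rightarrow> 'a) \<Rightarrow> 'a \<Rightarrow> 'a" where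
  "splice_hop e n m f = (if f \<in> e then n (m f) else f)"

definition splice_arc :: "'a set \<Rightarrow> ('a \<Rightarrow> 'a) \<Rightarrow> ('a \<Rightarrow> 'a) \<Rightarrow> 'a \<Rightarrow> 'a" where
  "splice_arc e n m f = splice_hop e n m (splice_hop e n m (n f))"

context
  fixes F e :: "'a set" and n m :: "'a \<Rightarrow> 'a"
  assumes fin: "finite F" and n: "pairing_on F n" and eF: "e \<subseteq> F" and card_e: "card e = 4"
    and m: "pairing_on e m"
begin

abbreviation "new_arc \<equiv> splice_arc e n m"

lemma arc_facts: "x \<in> F \<Longrightarrow> n x \<in> F" "x \<in> F \<Longrightarrow> n (n x) = x" "x \<in> F \<Longrightarrow> n x \<noteq> x"
  using n by (auto simp: pairing_on_def)

lemma match_facts: "x \<in> e \<Longrightarrow> m x \<in> e" "x \<in> e \<Longrightarrow> m (m x) = x" "x \<in> e \<Longrightarrow> m x \<noteq> x"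
  using m by (auto simp: pairing_on_def)

lemma walk_cases:
  assumes x: "x \<in> F - e"
  obtains
    (zero) "n x \<in> F - e" "new_arc x = n x"
  | (one) g where "n x \<in> e" "g = n (m (n x))" "g \<in> F - e" "new_arc x = g" "g \<noteq> x"
  | (two) g3 g where "n x \<in> e" "g3 = n (m (n x))" "g3 \<in> e" "g = n (m g3)" "g \<in> F - e"
      "new_arc x = g" "g \<noteq> x"
proof (cases "n x \<in> e")
  case False
  then show thesis using x arc_facts zero by (auto simp: splice_arc_def splice_hop_def)
next
  case True
  define g1 g2 g3 where "g1 = n x" and "g2 = m g1" and "g3 = n g2"
  have g1: "g1 \<in> e" "n g1 = x" using True x arc_facts by (auto simp: g1_def)
  have g2: "g2 \<in> e" "m g2 = g1" "g2 \<noteq> g1" using g1 match_facts by (auto simp: g2_def)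
  have g3: "g3 \<in> F" "n g3 = g2" "g3 \<noteq> g2" using g2 eF arc_facts by (auto simp: g3_def)
  have "g3 \<noteq> x" using g3 g2 by (metis g1_def)
  show thesis
  proof (cases "g3 \<in> e")
    case False
    then show thesis using True one[of g3] g3 \<open>g3 \<noteq> x\<close>
      by (auto simp: splice_arc_def splice_hop_def g1_def g2_def g3_def)
  next
    case True3: True
    define g4 g5 where "g4 = m g3" and "g5 = n g4"
    have "g3 \<noteq> g1" using g1 g3 x g2 by auto
    have g4: "g4 \<in> e" "m g4 = g3" "g4 \<noteq> g3" using True3 match_facts by (auto simp: g4_def)
    have "g4 \<noteq> g1" using g4 g3 g2 by (metis g2_def)
    moreover have "g4 \<noteq> g2" using g4 g2 \<open>g3 \<noteq> g1\<close> by metis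
    ultimately have e: "e = {g1, g2, g3, g4}"
      using four_elements[of e g1 g2 g3 g4] card_e g1 g2 g3 g4 True3 \<open>g3 \<noteq> g1\<close> by auto
    have g5: "g5 \<in> F" "n g5 = g4" "g5 \<noteq> g4" using g4 eF arc_facts by (auto simp: g5_def)
    have "g5 \<noteq> g1" using g5 g4 g1 x by auto
    moreover have "g5 \<noteq> g2" using g5 g4 g3_def by metis
    moreover have "g5 \<noteq> g3" using g5 g3 \<open>g4 \<noteq> g2\<close> by metis
    ultimately have "g5 \<in> F - e" using g5 e by auto
    moreover have "g5 \<noteq> x" using g5 \<open>g4 \<noteq> g1\<close> g1_def by metis
    ultimately show thesis using True two[of g3 g5] True3
      by (auto simp: splice_arc_def splice_hop_def g1_def g2_def g3_def g4_def g5_def)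
  qed
qed

lemma splice_arc_pairing: "pairing_on (F - e) new_arc"
proof -
  have "new_arc x \<in> F - e \<and> new_arc (new_arc x) = x \<and> new_arc x \<noteq> x" if x: "x \<in> F - e" for x
    using x
  proof (cases rule: walk_cases)
    case zero
    then show ?thesis using x arc_facts by (auto simp: splice_arc_def splice_hop_def)
  next
    case (one g)
    have "n g = m (n x)" using one match_facts arc_facts eF by (metis subsetD)
    then have "new_arc g = x" using x one match_facts arc_facts by (auto simp: splice_arc_def splice_hop_def)
    then show ?thesis using one by simp
  next
    case (two g3 g)
    have "n g = m g3" using two match_facts arc_facts eF by (metis subsetD)
    moreover have "n g3 = m (n x)" using two match_facts arc_facts eF by (metis subsetD)
    ultimately have "new_arc g = x" using x two match_facts arc_facts
      by (auto simp: splice_arc_def splice_hop_def)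
    then show ?thesis using two by simp
  qed
  then show ?thesis by (auto simp: pairing_on_def)
qed

abbreviation "walk_rel \<equiv> graph_on F n \<union> graph_on e m"

lemma sym_walk_rel: "sym walk_rel"
  using sym_graph_on[OF n] sym_graph_on[OF m] by (rule sym_Un)

lemma walk_rel_n: "x \<in> F \<Longrightarrow> (x, n x) \<in> walk_rel" and walk_rel_m: "x \<in> e \<Longrightarrow> (x, m x) \<in> walk_rel"
  by (auto simp: graph_on_iff)

lemma splice_arc_path:
  assumes x: "x \<in> F - e"
  shows "(x, new_arc x) \<in> walk_rel\<^sup>*"
  using x
proof (cases rule: walk_cases)
  case zero
  then show ?thesis using walk_rel_n x by auto
next
  case (one g)
  have p: "(x, n x) \<in> walk_rel" "(n x, m (n x)) \<in> walk_rel" "(m (n x), g) \<in> walk_rel"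
    using x one match_facts eF by (auto simp: graph_on_iff)
  show ?thesis unfolding one(4) by (rule rtrancl_into_rtrancl[OF rtrancl_into_rtrancl[OF r_into_rtrancl[OF p(1)] p(2)] p(3)])
next
  case (two g3 g)
  have p: "(x, n x) \<in> walk_rel" "(n x, m (n x)) \<in> walk_rel" "(m (n x), g3) \<in> walk_rel" "(g3, m g3) \<in> walk_rel" "(m g3, g) \<in> walk_rel"
    using x two match_facts eF by (auto simp: graph_on_iff)
  show ?thesis unfolding two(6) by (rule rtrancl_into_rtrancl[OF rtrancl_into_rtrancl[OF rtrancl_into_rtrancl[OF rtrancl_into_rtrancl[OF r_into_rtrancl[OF p(1)] p(2)] p(3)] p(4)] p(5)])
qed

lemma walk_reach_outside:
  assumes x: "x \<in> F - e" and path: "(x, y) \<in> walk_rel\<^sup>*" and y: "y \<in> F - e"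
  shows "y = x \<or> y = new_arc x"
  using x
proof (cases rule: walk_cases)
  case zero
  have "y \<in> {x, n x}"
    using path by (rule rtrancl_closed) (use zero x arc_facts in \<open>auto simp: graph_on_iff\<close>)
  then show ?thesis using zero by auto
next
  case (one g)
  have ng: "n g = m (n x)" using one match_facts arc_facts eF by (metis subsetD)
  have "y \<in> {x, n x, m (n x), g}"
    using path by (rule rtrancl_closed) (use one x arc_facts match_facts ng in \<open>auto simp: graph_on_iff\<close>)
  then show ?thesis using one y match_facts by auto
next
  case (two g3 g)
  have ng: "n g = m g3" using two match_facts arc_facts eF by (metis subsetD)
  have ng3: "n g3 = m (n x)" using two match_facts arc_facts eF by (metis subsetD)
  have "y \<in> {x, n x, m (n x), g3, m g3, g}"
    using path
    by (rule rtrancl_closed) (use two x arc_facts match_facts ng ng3 in \<open>auto simp: graph_on_iff\<close>)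
  then show ?thesis using two y match_facts by auto
qed

lemma card_classes_splice:
  assumes R: "R \<subseteq> (F - e) \<times> (F - e)" and symR: "sym R"
  shows "card (F // (walk_rel \<union> R)\<^sup>*) =
    card ((F - e) // (graph_on (F - e) new_arc \<union> R)\<^sup>*) + card {C \<in> F // (walk_rel \<union> R)\<^sup>*. C \<subseteq> e}"
proof -
  define Q where "Q = walk_rel \<union> R"
  define P where "P = graph_on (F - e) new_arc \<union> R"
  have symQ: "sym Q" unfolding Q_def using sym_walk_rel symR by (rule sym_Un)
  have P_in: "v \<in> F - e" if "u \<in> F - e" "(u, v) \<in> P" for u v
    using that R splice_arc_pairing by (auto simp: P_def graph_on_iff pairing_on_def)
  have Q_in: "v \<in> F" if "u \<in> F" "(u, v) \<in> Q" for u v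
    using that R arc_facts match_facts eF by (auto simp: Q_def graph_on_iff)
  have "(u, v) \<in> Q\<^sup>*" if "(u, v) \<in> P" for u v
  proof (cases "(u, v) \<in> R")
    case True
    then show ?thesis by (auto simp: Q_def)
  next
    case False
    then have "u \<in> F - e" "v = new_arc u" using that by (auto simp: P_def graph_on_iff)
    then have "(u, v) \<in> walk_rel\<^sup>*" using splice_arc_path by simp
    then show ?thesis unfolding Q_def using rtrancl_mono[of walk_rel "walk_rel \<union> R"] by blast
  qed
  then have "P \<subseteq> Q\<^sup>*" by auto
  then have PQ: "P\<^sup>* \<subseteq> Q\<^sup>*" by (rule rtrancl_subset_rtrancl)
  have outside: "(u, v) \<in> walk_rel\<^sup>* \<Longrightarrow> u \<in> F - e \<Longrightarrow> v \<in> F - e \<Longrightarrow> (u, v) \<in> P\<^sup>*" for u v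
    using walk_reach_outside[of u v] by (auto simp: P_def graph_on_iff)
  have QP: "(x, y) \<in> P\<^sup>*" if x: "x \<in> F - e" and y: "y \<in> F - e" and path: "(x, y) \<in> Q\<^sup>*" for x y
  proof -
    have "\<exists>u \<in> F - e. (x, u) \<in> P\<^sup>* \<and> (u, y) \<in> walk_rel\<^sup>*"
      using path
    proof (induction)
      case base
      then show ?case using x by auto
    next
      case (step y z)
      then obtain u where u: "u \<in> F - e" "(x, u) \<in> P\<^sup>*" "(u, y) \<in> walk_rel\<^sup>*" by auto
      show ?case
      proof (cases "(y, z) \<in> R")
        case True
        then have yz: "y \<in> F - e" "z \<in> F - e" using R by auto
        have "(x, y) \<in> P\<^sup>*" using u outside yz by (meson rtrancl_trans)
        moreover have "(y, z) \<in> P" using True by (simp add: P_def)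
        ultimately have "(x, z) \<in> P\<^sup>*" by (rule rtrancl.rtrancl_into_rtrancl)
        then show ?thesis using yz by blast
      next
        case False
        then have "(y, z) \<in> walk_rel" using step by (auto simp: Q_def)
        then show ?thesis using u(1,2) rtrancl.rtrancl_into_rtrancl[OF u(3)] by blast
      qed
    qed
    then show ?thesis using outside y by (meson rtrancl_trans)
  qed
  have image: "Q\<^sup>* `` {x} \<inter> (F - e) = P\<^sup>* `` {x}" if x: "x \<in> F - e" for x
  proof -
    have "y \<in> F - e" if "(x, y) \<in> P\<^sup>*" for y
      using rtrancl_closed[OF that x P_in] .
    then show ?thesis using QP[OF x] PQ by auto
  qed
  let ?A = "{C \<in> F // Q\<^sup>*. \<not> C \<subseteq> e}"
  have class_in: "Q\<^sup>* `` {x} \<subseteq> F" if "x \<in> F" for x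
    using rtrancl_closed[OF _ that Q_in] by auto
  have repr: "C = Q\<^sup>* `` {y}" if C: "C \<in> F // Q\<^sup>*" and y: "y \<in> C" for C y
  proof -
    obtain x where x: "C = Q\<^sup>* `` {x}" using C by (auto elim: quotientE)
    then have "(x, y) \<in> Q\<^sup>*" using y by auto
    then show ?thesis using x rtrancl_sym[OF symQ] by (auto intro: rtrancl_trans)
  qed
  have out: "\<exists>y \<in> F - e. y \<in> C \<and> C = Q\<^sup>* `` {y}" if CA: "C \<in> ?A" for C
  proof -
    obtain y where y: "y \<in> C" "y \<notin> e" using CA by auto
    have "C \<subseteq> F" using CA class_in by (auto elim!: quotientE)
    then show ?thesis using y repr[of C y] CA by blast
  qed
  have "bij_betw (\<lambda>C. C \<inter> (F - e)) ?A ((F - e) // P\<^sup>*)"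
  proof (rule bij_betwI')
    fix C D assume C: "C \<in> ?A" and D: "D \<in> ?A"
    show "(C \<inter> (F - e) = D \<inter> (F - e)) = (C = D)"
    proof
      assume eq: "C \<inter> (F - e) = D \<inter> (F - e)"
      obtain y where y: "y \<in> F - e" "y \<in> C" "C = Q\<^sup>* `` {y}" using out[OF C] by auto
      then have "y \<in> D" using eq by auto
      then show "C = D" using repr[of D y] D y by auto
    qed simp
  next
    fix C assume "C \<in> ?A"
    then obtain y where y: "y \<in> F - e" "C = Q\<^sup>* `` {y}" using out by blast
    then show "C \<inter> (F - e) \<in> (F - e) // P\<^sup>*" using image by (auto intro: quotientI)
  next
    fix D assume "D \<in> (F - e) // P\<^sup>*"
    then obtain x where x: "x \<in> F - e" "D = P\<^sup>* `` {x}" by (auto elim: quotientE)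
    then have "Q\<^sup>* `` {x} \<in> ?A" by (auto intro: quotientI)
    then show "\<exists>C\<in>?A. D = C \<inter> (F - e)" using image x by metis
  qed
  then have "card ?A = card ((F - e) // P\<^sup>*)" by (rule bij_betw_same_card)
  moreover have "F // Q\<^sup>* = ?A \<union> {C \<in> F // Q\<^sup>*. C \<subseteq> e}" by auto
  moreover have disj: "?A \<inter> {C \<in> F // Q\<^sup>*. C \<subseteq> e} = {}" by auto
  moreover have "finite (F // Q\<^sup>*)" using fin by (simp add: quotient_def)
  ultimately have "card (F // Q\<^sup>*) = card ((F - e) // P\<^sup>*) + card {C \<in> F // Q\<^sup>*. C \<subseteq> e}"
    using card_Un_disjoint[of ?A "{C \<in> F // Q\<^sup>*. C \<subseteq> e}"]
    by (metis (no_types, lifting) disj finite_Un)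
  then show ?thesis unfolding Q_def P_def .
qed

end

subsection \<open>Edges under the operations\<close>

lemma ribbon_graphD:
  assumes "ribbon_graph G"
  shows "finite (corners G)" "pairing_on (corners G) (seg G)" "pairing_on (corners G) (side G)"
    "pairing_on (corners G) (arc G)"
    "\<And>f. f \<in> corners G \<Longrightarrow> seg G (side G f) = side G (seg G f)"
    "\<And>f. f \<in> corners G \<Longrightarrow> seg G f \<noteq> side G f"
  using assms by (auto simp: ribbon_graph_def)

lemma pairing_onD:
  assumes "pairing_on A h" "x \<in> A"
  shows "h x \<in> A" "h (h x) = x" "h x \<noteq> x"
  using assms by (auto simp: pairing_on_def)

definition edge_of :: "('a, 'b) ribbon_scheme \<Rightarrow> 'a \<Rightarrow> 'a set" where
  "edge_of G f = {f, seg G f, side G f, side G (seg G f)}"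

lemma corner_facts:
  assumes G: "ribbon_graph G" and f: "f \<in> corners G"
  shows "seg G f \<in> corners G" "side G f \<in> corners G" "seg G (seg G f) = f" "side G (side G f) = f"
    "seg G f \<noteq> f" "side G f \<noteq> f" "seg G (side G f) = side G (seg G f)" "seg G f \<noteq> side G f"
    "side G (seg G f) \<in> corners G" "side G (seg G f) \<noteq> f" "side G (seg G f) \<noteq> seg G f"
    "side G (side G (seg G f)) = seg G f" "seg G (side G (seg G f)) = side G f"
    "side G (seg G f) \<noteq> side G f"
proof -
  note s = pairing_onD[OF ribbon_graphD(2)[OF G]] and t = pairing_onD[OF ribbon_graphD(3)[OF G]]
  show 1: "seg G f \<in> corners G" "side G f \<in> corners G" "seg G (seg G f) = f" "side G (side G f) = f"
    "seg G f \<noteq> f" "side G f \<noteq> f" "seg G (side G f) = side G (seg G f)" "seg G f \<noteq> side G f"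
    using s[OF f] t[OF f] ribbon_graphD(5,6)[OF G f] by auto
  show 2: "side G (seg G f) \<in> corners G" "side G (seg G f) \<noteq> seg G f"
    "side G (side G (seg G f)) = seg G f"
    using t[OF 1(1)] by auto
  show "seg G (side G (seg G f)) = side G f"
    using ribbon_graphD(5)[OF G 1(1)] 1(3) by simp
  show "side G (seg G f) \<noteq> f" using 2(3) 1(8) by metis
  show "side G (seg G f) \<noteq> side G f" using 2(3) 1(4,5) by metis
qed

lemma edge_of_closed:
  assumes "ribbon_graph G" "f \<in> corners G" "g \<in> edge_of G f"
  shows "g \<in> corners G" "seg G g \<in> edge_of G f" "side G g \<in> edge_of G f" "edge_of G g = edge_of G f"
  using assms(2,3) unfolding edge_of_def by (auto simp: corner_facts[OF assms(1,2)])

lemma conn_edge_of: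
  assumes G: "ribbon_graph G" and f: "f \<in> corners G"
  shows "conn {seg G, side G} (corners G) `` {f} = edge_of G f"
proof -
  let ?R = "{(x, h x) | x h. x \<in> corners G \<and> h \<in> {seg G, side G}}"
  have "g \<in> edge_of G f" if "(f, g) \<in> ?R\<^sup>*" for g
    using that by (rule rtrancl_closed) (use edge_of_closed(2,3)[OF G f] in \<open>auto simp: edge_of_def[of G f]\<close>)
  moreover have "(f, g) \<in> ?R\<^sup>*" if "g \<in> edge_of G f" for g
  proof -
    have 1: "(f, seg G f) \<in> ?R" "(f, side G f) \<in> ?R" using f by auto
    have "seg G f \<in> corners G" using corner_facts(1)[OF G f] .
    then have "(seg G f, side G (seg G f)) \<in> ?R" by auto
    then have "(f, side G (seg G f)) \<in> ?R\<^sup>*" using 1(1) by (meson r_into_rtrancl rtrancl_into_rtrancl)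
    then show ?thesis using that 1 by (auto simp: edge_of_def)
  qed
  ultimately show ?thesis by (auto simp: conn_def)
qed

lemma edges_eq:
  assumes G: "ribbon_graph G"
  shows "edges G = edge_of G ` corners G"
  using conn_edge_of[OF G] by (auto simp: edges_def orbits_def quotient_def)

lemma edge_facts:
  assumes G: "ribbon_graph G" and e: "e \<in> edges G"
  shows "e \<subseteq> corners G" "card e = 4" "pairing_on e (seg G)" "pairing_on e (side G)"
    "pairing_on e (\<lambda>f. side G (seg G f))" "\<And>f. f \<in> e \<Longrightarrow> edge_of G f = e"
proof -
  obtain f where f: "f \<in> corners G" "e = edge_of G f" using e edges_eq[OF G] by auto
  note closed = edge_of_closed[OF G f(1), folded f(2)]
  show sub: "e \<subseteq> corners G" using closed(1) by blast
  show "\<And>f. f \<in> e \<Longrightarrow> edge_of G f = e" using closed f by auto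
  note c = corner_facts[OF G]
  show "pairing_on e (seg G)" "pairing_on e (side G)" "pairing_on e (\<lambda>f. side G (seg G f))"
    unfolding pairing_on_def using closed(1-3) c by simp_all
  have "distinct [f, seg G f, side G f, side G (seg G f)]"
    using c(5,6,8,10,11,14)[OF f(1)] c(5,6,10,11,14)[OF f(1), THEN not_sym] by simp
  then show "card e = 4" unfolding f edge_of_def by simp
qed

lemma finite_edges: "ribbon_graph G \<Longrightarrow> finite (edges G)"
  by (simp add: edges_eq ribbon_graphD)

lemma edges_disjoint:
  assumes "ribbon_graph G" "e \<in> edges G" "e' \<in> edges G" "e \<noteq> e'"
  shows "e \<inter> e' = {}"
  using edge_facts(6)[OF assms(1,2)] edge_facts(6)[OF assms(1,3)] assms(4) by auto

lemma petrial_simps [simp]: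
  "corners (partial_petrial e G) = corners G" "seg (partial_petrial e G) = seg G"
  "side (partial_petrial e G) = (\<lambda>f. if f \<in> e then side G (seg G f) else side G f)"
  "arc (partial_petrial e G) = arc G" "isolated (partial_petrial e G) = isolated G"
  by (simp_all add: partial_petrial_def)

lemma
  assumes G: "ribbon_graph G" and e: "e \<in> edges G"
  shows ribbon_graph_petrial: "ribbon_graph (partial_petrial e G)"
    and edges_petrial: "edges (partial_petrial e G) = edges G"
proof -
  note c = corner_facts[OF G]
  note E = edge_facts[OF G e]
  note es = pairing_onD[OF E(3)] and et = pairing_onD[OF E(4)] and est = pairing_onD[OF E(5)]
  have nes: "seg G f \<in> e \<longleftrightarrow> f \<in> e" if "f \<in> corners G" for f
    using that c(1,3) es by metis
  have net: "side G f \<in> e \<longleftrightarrow> f \<in> e" if "f \<in> corners G" for f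
    using that c(2,4) et by metis
  have "pairing_on (corners G) (side (partial_petrial e G))"
    unfolding pairing_on_def
  proof
    fix x assume x: "x \<in> corners G"
    let ?s = "side (partial_petrial e G)"
    show "?s x \<in> corners G \<and> ?s (?s x) = x \<and> ?s x \<noteq> x"
    proof (cases "x \<in> e")
      case True
      then show ?thesis using c(9)[OF x] est[OF True] by simp
    next
      case False
      then show ?thesis using c(2,4,6)[OF x] net[OF x] by simp
    qed
  qed
  moreover have "seg G (side (partial_petrial e G) f) = side (partial_petrial e G) (seg G f)
      \<and> seg G f \<noteq> side (partial_petrial e G) f" if f: "f \<in> corners G" for f
    using nes[OF f] c[OF f] by simp
  ultimately show *: "ribbon_graph (partial_petrial e G)"
    using ribbon_graphD[OF G] by (simp add: ribbon_graph_def)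
  have "edge_of (partial_petrial e G) f = edge_of G f" if "f \<in> corners G" for f
    using nes[OF that] c[OF that] by (auto simp: edge_of_def)
  then show "edges (partial_petrial e G) = edges G"
    unfolding edges_eq[OF G] edges_eq[OF *] by auto
qed

lemma remove_simps [simp]:
  "corners (remove_edge_along m e G) = corners G - e"
  "seg (remove_edge_along m e G) = seg G"
  "side (remove_edge_along m e G) = side G"
  "arc (remove_edge_along m e G) = splice_arc e (arc G) m"
  by (auto simp: remove_edge_along_def Let_def splice_arc_def splice_hop_def fun_eq_iff)

lemma
  assumes G: "ribbon_graph G" and e: "e \<in> edges G" and m: "pairing_on e m"
  shows ribbon_graph_remove: "ribbon_graph (remove_edge_along m e G)"
    and edges_remove: "edges (remove_edge_along m e G) = edges G - {e}"
proof -
  note c = corner_facts[OF G]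
  note E = edge_facts[OF G e]
  note es = pairing_onD[OF E(3)] and et = pairing_onD[OF E(4)]
  have nes: "seg G f \<in> e \<longleftrightarrow> f \<in> e" if "f \<in> corners G" for f
    using that c(1,3) es by metis
  have net: "side G f \<in> e \<longleftrightarrow> f \<in> e" if "f \<in> corners G" for f
    using that c(2,4) et by metis
  have "pairing_on (corners G - e) (splice_arc e (arc G) m)"
    using splice_arc_pairing[OF ribbon_graphD(1,4)[OF G] E(1,2) m] .
  moreover have "pairing_on (corners G - e) (seg G)" "pairing_on (corners G - e) (side G)"
    using c nes net by (auto simp: pairing_on_def)
  ultimately show *: "ribbon_graph (remove_edge_along m e G)"
    using ribbon_graphD[OF G] by (simp add: ribbon_graph_def)
  have "edge_of (remove_edge_along m e G) f = edge_of G f" for f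
    by (simp add: edge_of_def)
  then have "edges (remove_edge_along m e G) = edge_of G ` (corners G - e)"
    unfolding edges_eq[OF *] by auto
  also have "\<dots> = edges G - {e}"
    using E(6) unfolding edges_eq[OF G] by (auto simp: edge_of_def)
  finally show "edges (remove_edge_along m e G) = edges G - {e}" .
qed

subsection \<open>Omega as a sum over states\<close>

text \<open>
  A state assigns to each light edge one of the four terms of the recurrence: 0 for contraction to a
  point, 1 for contraction, 2 for deletion, 3 for Penrose-contraction.
\<close>

definition state_pairing :: "('a, 'b) ribbon_scheme \<Rightarrow> nat \<Rightarrow> 'a \<Rightarrow> 'a" where
  "state_pairing G k f = (if k = 1 then side G f else if k = 2 then seg G f else side G (seg G f))"

definition state_steps :: "('a, 'b) ribbon_scheme \<Rightarrow> nat \<Rightarrow> 'a set \<Rightarrow> ('a \<times> 'a) set" where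
  "state_steps G k e = (if k = 0 then e \<times> e else graph_on e (state_pairing G k))"

definition states_steps ::
    "'a edge_point_ribbon \<Rightarrow> ('a set \<Rightarrow> nat) \<Rightarrow> 'a set set \<Rightarrow> ('a \<times> 'a) set" where
  "states_steps G \<sigma> E = (\<Union>e\<in>E. state_steps G (if e \<in> dark G then 0 else \<sigma> e) e)"

definition state_rel :: "'a edge_point_ribbon \<Rightarrow> ('a set \<Rightarrow> nat) \<Rightarrow> ('a \<times> 'a) set" where
  "state_rel G \<sigma> = graph_on (corners G) (arc G) \<union> states_steps G \<sigma> (edges G)"

definition state_kappa :: "'a edge_point_ribbon \<Rightarrow> ('a set \<Rightarrow> nat) \<Rightarrow> nat" where
  "state_kappa G \<sigma> = isolated G + card (corners G // (state_rel G \<sigma>)\<^sup>*)"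

definition state_weight :: "nat \<Rightarrow> poly_wxyzt" where
  "state_weight k = (if k = 0 then var_w else if k = 1 then var_x else if k = 2 then var_y else var_z)"

definition state_sum :: "'a edge_point_ribbon \<Rightarrow> poly_wxyzt" where
  "state_sum G = (\<Sum>\<sigma> \<in> light_edges G \<rightarrow>\<^sub>E {0..<4}.
     (\<Prod>e\<in>light_edges G. state_weight (\<sigma> e)) * var_t ^ state_kappa G \<sigma>)"

lemma pairing_state:
  "ribbon_graph G \<Longrightarrow> e \<in> edges G \<Longrightarrow> pairing_on e (state_pairing G k)"
  using edge_facts[of G e] by (auto simp: state_pairing_def pairing_on_def)

lemma sym_states_steps:
  assumes "ribbon_graph G" "E \<subseteq> edges G"
  shows "sym (states_steps G \<sigma> E)"
proof -
  have "sym (state_steps G k e)" if "e \<in> E" for k e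
    using sym_graph_on[OF pairing_state[OF assms(1)]] that assms(2)
    by (auto simp: state_steps_def intro: symI)
  then show ?thesis unfolding states_steps_def by (intro sym_UNION) auto
qed

lemma states_steps_subset:
  assumes "ribbon_graph G" "E \<subseteq> edges G"
  shows "states_steps G \<sigma> E \<subseteq> \<Union>E \<times> \<Union>E"
proof -
  have "state_steps G k e \<subseteq> e \<times> e" if "e \<in> E" for k e
    using pairing_onD[OF pairing_state[OF assms(1)]] that assms(2)
    by (auto simp: state_steps_def graph_on_iff split: if_splits)
  then show ?thesis unfolding states_steps_def by blast
qed

lemma state_kappa_remove:
  assumes G: "edge_point_ribbon_graph G" and e: "e \<in> light_edges G"
    and k: "k \<noteq> 0" and m: "\<And>f. f \<in> e \<Longrightarrow> m f = state_pairing G k f"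
    and H: "corners H = corners G - e" "arc H = splice_arc e (arc G) m"
      "isolated H = isolated G + card {C \<in> orbits {\<lambda>f. if f \<in> e then m f else seg G f, arc G} (corners G). C \<subseteq> e}"
      "states_steps H \<sigma> (edges H) = states_steps G \<sigma> (edges G - {e})"
  shows "state_kappa H \<sigma> = state_kappa G (\<sigma>(e := k))"
proof -
  let ?F = "corners G"
  have G': "ribbon_graph G" and e': "e \<in> edges G" "e \<notin> dark G"
    using G e by (auto simp: edge_point_ribbon_graph_def light_edges_def)
  note E = edge_facts[OF G' e'(1)]
  have pm: "pairing_on e m" using pairing_state[OF G' e'(1), of k] m by (simp add: pairing_on_def)
  define R where "R = states_steps G \<sigma> (edges G - {e})"
  have "\<Union>(edges G - {e}) \<subseteq> ?F - e"
    using edges_disjoint[OF G' e'(1)] edge_facts(1)[OF G'] by blast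
  then have R_sub: "R \<subseteq> (?F - e) \<times> (?F - e)"
    using states_steps_subset[OF G', of "edges G - {e}" \<sigma>] unfolding R_def by blast
  have symR: "sym R" unfolding R_def by (rule sym_states_steps[OF G']) auto
  have edges_insert: "edges G = insert e (edges G - {e})" using e' by auto
  have "states_steps G (\<sigma>(e := k)) (edges G) = state_steps G k e \<union> states_steps G (\<sigma>(e := k)) (edges G - {e})"
    using e' unfolding states_steps_def by (subst edges_insert) (simp del: insert_Diff_single)
  also have "state_steps G k e = graph_on e m"
    using k m by (auto simp: state_steps_def graph_on_iff)
  also have "states_steps G (\<sigma>(e := k)) (edges G - {e}) = R"
    unfolding states_steps_def R_def by (intro SUP_cong) auto
  finally have rel: "state_rel G (\<sigma>(e := k)) = graph_on ?F (arc G) \<union> graph_on e m \<union> R"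
    unfolding state_rel_def by (simp only: Un_assoc)
  have relH: "state_rel H \<sigma> = graph_on (?F - e) (splice_arc e (arc G) m) \<union> R"
    by (simp add: state_rel_def H R_def)
  have "{C \<in> ?F // (graph_on ?F (arc G) \<union> graph_on e m \<union> R)\<^sup>*. C \<subseteq> e}
      = {C \<in> orbits {\<lambda>f. if f \<in> e then m f else seg G f, arc G} ?F. C \<subseteq> e}"
    unfolding orbits_def conn_def
  proof (rule trapped_classes)
    fix u v assume u: "u \<in> e"
    then have "(u, v) \<in> graph_on ?F (arc G) \<union> graph_on e m \<union> R \<longleftrightarrow> v = arc G u \<or> v = m u"
      using R_sub E(1) by (auto simp: graph_on_iff)
    also have "\<dots> \<longleftrightarrow> (u, v) \<in> {(x, h x) | x h. x \<in> ?F \<and>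
        h \<in> {\<lambda>f. if f \<in> e then m f else seg G f, arc G}}"
      using u E(1) by (auto intro: exI[of _ "\<lambda>f. if f \<in> e then m f else seg G f"])
    finally show "(u, v) \<in> graph_on ?F (arc G) \<union> graph_on e m \<union> R \<longleftrightarrow>
      (u, v) \<in> {(x, h x) | x h. x \<in> ?F \<and>
        h \<in> {\<lambda>f. if f \<in> e then m f else seg G f, arc G}}" .
  qed
  then show ?thesis
    using card_classes_splice[OF ribbon_graphD(1,4)[OF G'] E(1,2) pm R_sub symR]
    by (simp add: state_kappa_def rel relH H)
qed

definition state_op :: "nat \<Rightarrow> 'a set \<Rightarrow> 'a edge_point_ribbon \<Rightarrow> 'a edge_point_ribbon" where
  "state_op k e G = (if k = 0 then edge_to_point e G else if k = 1 then contract_edge e G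
     else if k = 2 then delete_edge e G else penrose_contract_edge e G)"

lemma dark_ops [simp]:
  "dark (partial_petrial e G) = dark G" "dark (remove_edge_along m e G) = dark G"
  by (simp_all add: partial_petrial_def remove_edge_along_def Let_def)

lemma isolated_remove:
  "isolated (remove_edge_along m e G) =
     isolated G + card {C \<in> orbits {\<lambda>f. if f \<in> e then m f else seg G f, arc G} (corners G). C \<subseteq> e}"
  by (simp add: remove_edge_along_def Let_def)

lemma states_steps_cong:
  assumes "dark H = dark G" "seg H = seg G"
    and "\<And>e f. e \<in> E \<Longrightarrow> e \<notin> dark G \<Longrightarrow> f \<in> e \<Longrightarrow> side H f = side G f \<and> side H (seg G f) = side G (seg G f)"
  shows "states_steps H \<sigma> E = states_steps G \<sigma> E"
  unfolding states_steps_def state_steps_def using assms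
  by (intro SUP_cong) (auto simp: graph_on_iff state_pairing_def)

lemma
  assumes G: "edge_point_ribbon_graph G" and e: "e \<in> light_edges G"
  shows edge_point_ribbon_graph_op: "edge_point_ribbon_graph (state_op k e G)"
    and light_edges_op: "light_edges (state_op k e G) = light_edges G - {e}"
    and state_kappa_op: "k < 4 \<Longrightarrow> state_kappa (state_op k e G) \<sigma> = state_kappa G (\<sigma>(e := k))"
proof -
  have G': "ribbon_graph G" and e': "e \<in> edges G" "e \<notin> dark G" and D: "dark G \<subseteq> edges G"
    using G e by (auto simp: edge_point_ribbon_graph_def light_edges_def)
  note E = edge_facts[OF G' e'(1)]
  let ?P = "partial_petrial e G"
  note P = ribbon_graph_petrial[OF G' e'(1)] edges_petrial[OF G' e'(1)]
  have eP: "e \<in> edges ?P" using P e' by simp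
  have sideP: "pairing_on e (side ?P)" by (rule edge_facts(4)[OF P(1) eP])
  consider (p) "k = 0" | (c) "k = 1" | (d) "k = 2" | (q) "k \<noteq> 0" "k \<noteq> 1" "k \<noteq> 2" by blast
  then have *: "edge_point_ribbon_graph (state_op k e G) \<and> light_edges (state_op k e G) = light_edges G - {e}
     \<and> (k < 4 \<longrightarrow> state_kappa (state_op k e G) \<sigma> = state_kappa G (\<sigma>(e := k)))"
  proof cases
    case p
    have [simp]: "edges (edge_to_point e G) = edges G" "ribbon_graph (edge_to_point e G)"
      using G' by (simp_all add: edges_def ribbon_graph_def edge_to_point_def)
    have sp: "state_pairing (edge_to_point e G) = state_pairing G"
      by (auto simp: fun_eq_iff state_pairing_def edge_to_point_def)
    have "states_steps (edge_to_point e G) \<sigma> (edges G) = states_steps G (\<sigma>(e := 0)) (edges G)"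
      unfolding states_steps_def state_steps_def sp
      by (intro SUP_cong) (auto simp: edge_to_point_def)
    then have "state_rel (edge_to_point e G) \<sigma> = state_rel G (\<sigma>(e := 0))"
      by (simp add: state_rel_def) (simp add: edge_to_point_def)
    then have "state_kappa (edge_to_point e G) \<sigma> = state_kappa G (\<sigma>(e := 0))"
      by (simp add: state_kappa_def) (simp add: edge_to_point_def)
    moreover have "dark (edge_to_point e G) = insert e (dark G)"
      by (simp add: edge_to_point_def)
    ultimately show ?thesis using p e' D
      by (auto simp: state_op_def edge_point_ribbon_graph_def light_edges_def)
  next
    case c
    let ?H = "remove_edge_along (side G) e G"
    note H = ribbon_graph_remove[OF G' e'(1) E(4)] edges_remove[OF G' e'(1) E(4)]
    have "state_kappa ?H \<sigma> = state_kappa G (\<sigma>(e := k))"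
    proof (rule state_kappa_remove[OF G e, where m = "side G"])
      show "states_steps ?H \<sigma> (edges ?H) = states_steps G \<sigma> (edges G - {e})"
        unfolding H by (rule states_steps_cong) simp_all
    qed (use c in \<open>simp_all add: state_pairing_def isolated_remove\<close>)
    then show ?thesis using c e' D H
      by (auto simp: state_op_def edge_point_ribbon_graph_def light_edges_def contract_edge_def)
  next
    case d
    let ?H = "remove_edge_along (seg G) e G"
    note H = ribbon_graph_remove[OF G' e'(1) E(3)] edges_remove[OF G' e'(1) E(3)]
    have "state_kappa ?H \<sigma> = state_kappa G (\<sigma>(e := k))"
    proof (rule state_kappa_remove[OF G e, where m = "seg G"])
      show "states_steps ?H \<sigma> (edges ?H) = states_steps G \<sigma> (edges G - {e})"
        unfolding H by (rule states_steps_cong) simp_all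
    qed (use d in \<open>simp_all add: state_pairing_def isolated_remove\<close>)
    then show ?thesis using d e' D H
      by (auto simp: state_op_def edge_point_ribbon_graph_def light_edges_def delete_edge_def)
  next
    case q
    let ?H = "remove_edge_along (side ?P) e ?P"
    note H = ribbon_graph_remove[OF P(1) eP sideP] edges_remove[OF P(1) eP sideP]
    have "state_kappa ?H \<sigma> = state_kappa G (\<sigma>(e := k))"
    proof (rule state_kappa_remove[OF G e, where m = "side ?P"])
      show "states_steps ?H \<sigma> (edges ?H) = states_steps G \<sigma> (edges G - {e})"
        unfolding H P(2)
      proof (rule states_steps_cong)
        fix e2 f assume e2: "e2 \<in> edges G - {e}" and f: "f \<in> e2"
        have "seg G f \<in> e2" using edge_facts(3)[OF G'] e2 f pairing_onD(1) by (metis DiffD1)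
        then have "f \<notin> e" "seg G f \<notin> e" using edges_disjoint[OF G' e'(1)] e2 f by blast+
        then show "side ?H f = side G f \<and> side ?H (seg G f) = side G (seg G f)" by simp
      qed auto
    qed (use q in \<open>simp_all add: state_pairing_def isolated_remove cong: if_cong\<close>)
    then show ?thesis using q e' D H P
      by (auto simp: state_op_def edge_point_ribbon_graph_def light_edges_def
          penrose_contract_edge_def contract_edge_def)
  qed
  then show "edge_point_ribbon_graph (state_op k e G)"
    "light_edges (state_op k e G) = light_edges G - {e}"
    "k < 4 \<Longrightarrow> state_kappa (state_op k e G) \<sigma> = state_kappa G (\<sigma>(e := k))" by auto
qed

lemma finite_light_edges: "edge_point_ribbon_graph G \<Longrightarrow> finite (light_edges G)"
  by (simp add: edge_point_ribbon_graph_def light_edges_def finite_edges)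

lemma sum_0_4: "(\<Sum>k\<in>{0..<4::nat}. h k) = h 0 + h 1 + h 2 + h 3"
  by (simp add: eval_nat_numeral)

lemma state_sum_rec:
  assumes G: "edge_point_ribbon_graph G" and e: "e \<in> light_edges G"
  shows "state_sum G = var_w * state_sum (edge_to_point e G) + var_x * state_sum (contract_edge e G)
    + var_y * state_sum (delete_edge e G) + var_z * state_sum (penrose_contract_edge e G)"
proof -
  let ?L = "light_edges G - {e}"
  have L: "light_edges G = insert e ?L" using e by auto
  have fin: "finite ?L" using finite_light_edges[OF G] by simp
  let ?term = "\<lambda>\<sigma>. (\<Prod>d\<in>light_edges G. state_weight (\<sigma> d)) * var_t ^ state_kappa G \<sigma>"
  have "state_sum G = (\<Sum>\<sigma> \<in> insert e ?L \<rightarrow>\<^sub>E {0..<4}. ?term \<sigma>)"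
    unfolding state_sum_def L[symmetric] ..
  also have "\<dots> = (\<Sum>(k, \<sigma>) \<in> {0..<4} \<times> (?L \<rightarrow>\<^sub>E {0..<4}). ?term (\<sigma>(e := k)))"
    unfolding PiE_insert_eq
    by (subst sum.reindex[OF inj_combinator]) (auto simp: case_prod_unfold)
  also have "\<dots> = (\<Sum>k\<in>{0..<4}. \<Sum>\<sigma> \<in> ?L \<rightarrow>\<^sub>E {0..<4}. ?term (\<sigma>(e := k)))"
    by (rule sum.cartesian_product[symmetric])
  also have "\<dots> = (\<Sum>k\<in>{0..<4}. state_weight k * state_sum (state_op k e G))"
  proof (rule sum.cong[OF refl])
    fix k :: nat assume k: "k \<in> {0..<4}"
    have "?term (\<sigma>(e := k)) = state_weight k *
        ((\<Prod>d\<in>?L. state_weight (\<sigma> d)) * var_t ^ state_kappa (state_op k e G) \<sigma>)" for \<sigma>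
    proof -
      have "(\<Prod>d\<in>light_edges G. state_weight ((\<sigma>(e := k)) d))
          = state_weight k * (\<Prod>d\<in>?L. state_weight ((\<sigma>(e := k)) d))"
        using prod.remove[OF finite_light_edges[OF G] e, of "\<lambda>d. state_weight ((\<sigma>(e := k)) d)"]
        by (simp only: fun_upd_same)
      also have "(\<Prod>d\<in>?L. state_weight ((\<sigma>(e := k)) d)) = (\<Prod>d\<in>?L. state_weight (\<sigma> d))"
        by (rule prod.cong) auto
      finally show ?thesis using state_kappa_op[OF G e, of k \<sigma>] k by (simp add: mult.assoc)
    qed
    then show "(\<Sum>\<sigma> \<in> ?L \<rightarrow>\<^sub>E {0..<4}. ?term (\<sigma>(e := k))) = state_weight k * state_sum (state_op k e G)"
      unfolding state_sum_def light_edges_op[OF G e] by (simp add: sum_distrib_left)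
  qed
  finally show ?thesis by (simp add: sum_0_4 state_op_def state_weight_def)
qed

lemma state_sum_edgeless:
  assumes G: "edge_point_ribbon_graph G" and L: "light_edges G = {}"
  shows "state_sum G = var_t ^ kappa G"
proof -
  have G': "ribbon_graph G" and D: "dark G = edges G"
    using G L by (auto simp: edge_point_ribbon_graph_def light_edges_def)
  let ?R = "{(x, h x) | x h. x \<in> corners G \<and> h \<in> {seg G, side G, arc G}}"
  have "(state_rel G \<sigma>)\<^sup>* = ?R\<^sup>*" for \<sigma>
  proof
    have *: "(f, g) \<in> ?R\<^sup>*" if "e \<in> edges G" "f \<in> e" "g \<in> e" for e f g
    proof -
      have f: "f \<in> corners G" and e: "e = edge_of G f" using edge_facts(1,6)[OF G' that(1)] that by auto
      then have "(f, g) \<in> conn {seg G, side G} (corners G)" using conn_edge_of[OF G'] that by auto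
      moreover have "{(x, h x) | x h. x \<in> corners G \<and> h \<in> {seg G, side G}} \<subseteq> ?R" by auto
      ultimately show ?thesis unfolding conn_def using rtrancl_mono by blast
    qed
    have "state_rel G \<sigma> \<subseteq> ?R\<^sup>*"
      unfolding state_rel_def states_steps_def state_steps_def
      using D * by (auto simp: graph_on_def)
    then show "(state_rel G \<sigma>)\<^sup>* \<subseteq> ?R\<^sup>*" by (rule rtrancl_subset_rtrancl)
    have "(x, seg G x) \<in> state_rel G \<sigma>" "(x, side G x) \<in> state_rel G \<sigma>" if "x \<in> corners G" for x
      using that D unfolding state_rel_def states_steps_def state_steps_def
      by (auto simp: edges_eq[OF G'] edge_of_def)
    then have "?R \<subseteq> state_rel G \<sigma>" by (auto simp: state_rel_def graph_on_def)
    then show "?R\<^sup>* \<subseteq> (state_rel G \<sigma>)\<^sup>*" by (rule rtrancl_mono)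
  qed
  then show ?thesis unfolding state_sum_def L
    by (simp add: state_kappa_def kappa_def orbits_def conn_def)
qed

lemma is_Omega_state_sum:
  "is_Omega (\<lambda>G :: 'a edge_point_ribbon. if edge_point_ribbon_graph G then state_sum G else 0)"
proof -
  have "edge_point_ribbon_graph (edge_to_point e G)" "edge_point_ribbon_graph (contract_edge e G)"
    "edge_point_ribbon_graph (delete_edge e G)" "edge_point_ribbon_graph (penrose_contract_edge e G)"
    if "edge_point_ribbon_graph G" "e \<in> light_edges G" for e and G :: "'a edge_point_ribbon"
    using edge_point_ribbon_graph_op[OF that, of 0] edge_point_ribbon_graph_op[OF that, of 1]
      edge_point_ribbon_graph_op[OF that, of 2] edge_point_ribbon_graph_op[OF that, of 3]
    by (simp_all add: state_op_def)
  then show ?thesis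
    unfolding is_Omega_def using state_sum_rec state_sum_edgeless by auto
qed

lemma is_Omega_unique:
  assumes \<Phi>: "is_Omega \<Phi>" and \<Psi>: "is_Omega \<Psi>"
  shows "\<Phi> = \<Psi>"
proof
  fix G
  show "\<Phi> G = \<Psi> G"
  proof (induction "card (light_edges G)" arbitrary: G rule: less_induct)
    case less
    consider "\<not> edge_point_ribbon_graph G" | "edge_point_ribbon_graph G" "light_edges G = {}"
      | e where "edge_point_ribbon_graph G" "e \<in> light_edges G" by blast
    then show ?case
    proof cases
      case (3 e)
      have "card (light_edges (state_op k e G)) < card (light_edges G)" for k
        using light_edges_op[OF 3, of k] finite_light_edges[OF 3(1)] 3(2)
        by (metis card_Diff1_less)
      then have IH: "\<Phi> (state_op k e G) = \<Psi> (state_op k e G)" for k using less by blast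
      show ?thesis
        using 3 \<Phi> \<Psi> IH[of 0] IH[of 1] IH[of 2] IH[of 3] by (simp add: is_Omega_def state_op_def)
    qed (use \<Phi> \<Psi> in \<open>auto simp: is_Omega_def\<close>)
  qed
qed

theorem is_Omega_Omega: "is_Omega Omega"
  unfolding Omega_def
  by (rule theI[of is_Omega, OF is_Omega_state_sum]) (rule is_Omega_unique[OF _ is_Omega_state_sum])

theorem Omega_eq_state_sum: "edge_point_ribbon_graph G \<Longrightarrow> Omega G = state_sum G"
  using fun_cong[OF is_Omega_unique[OF is_Omega_Omega is_Omega_state_sum], of G] by simp

text \<open>
  Edge-point ribbon graphs are 2-coloured ribbon graphs up to partial Petrials of dark edges;
  Omega does not depend on the chosen representative.
\<close>

theorem Omega_petrial_dark:
  assumes G: "edge_point_ribbon_graph G" and e: "e \<in> dark G"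
  shows "Omega (partial_petrial e G) = Omega G"
proof -
  have G': "ribbon_graph G" and D: "dark G \<subseteq> edges G" and e': "e \<in> edges G"
    using G e by (auto simp: edge_point_ribbon_graph_def)
  note P = ribbon_graph_petrial[OF G' e'] edges_petrial[OF G' e']
  have "edge_point_ribbon_graph (partial_petrial e G)"
    using P D by (simp add: edge_point_ribbon_graph_def)
  moreover have "states_steps (partial_petrial e G) \<sigma> (edges G) = states_steps G \<sigma> (edges G)" for \<sigma>
  proof (rule states_steps_cong)
    fix e2 f assume e2: "e2 \<in> edges G" "e2 \<notin> dark G" and f: "f \<in> e2"
    have "seg G f \<in> e2" using edge_facts(3)[OF G' e2(1)] f pairing_onD(1) by metis
    then have "f \<notin> e" "seg G f \<notin> e" using edges_disjoint[OF G' e'] e e2 f by blast+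
    then show "side (partial_petrial e G) f = side G f
      \<and> side (partial_petrial e G) (seg G f) = side G (seg G f)" by simp
  qed auto
  ultimately show ?thesis
    using G P by (simp add: Omega_eq_state_sum state_sum_def light_edges_def state_kappa_def state_rel_def)
qed

end

theory Submission
  imports Defs
begin

text \<open>
  \<open>Omega\<close> is a sum over states, in which every edge is contracted to a point, contracted, deleted or
  Penrose-contracted, and a state with \<open>k\<close> components contributes \<open>t\<^sup>k\<close> times the weights of its
  choices. For \<open>t = 3\<close>, the power counts the maps from its components to three colours, that is, the
  colourings of the vertex arcs of \<open>G\<close> that agree wherever the state joins two arcs. Summing over
  the colourings first turns the state sum into a sum over colourings of the arcs of a
  product of local factors, one for each edge (\<open>eval_Omega_boundary_colourings\<close>).

  At the weights \<open>(-2, 1, 0, 1)\<close> the local factor depends on the colours of the four arcs that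
  meet the corners of the edge. Contraction asks for equal colours along both sides of the edge, and
  Penrose-contraction for equal colours at diagonally opposite corners. If both hold, then all
  four colours agree, the contraction to a point is admissible too, and the factor is
  \<open>-2 + 1 + 1 = 0\<close>. If exactly one of them holds, then each end of the edge separates the same two
  different colours, and the factor is 1. Otherwise it is 0 (\<open>local_weight\<close>).

  So the value counts the colourings of arcs in which, for two different colours depending on the
  edge, both ends of the edge lie between arcs of those two colours. Give the edge the third colour. At
  a cubic vertex, the three arcs are pairwise adjacent and hence have three different colours, so
  the three edge-ends get different colours as well, and every arc has the colour of the edge-end
  opposite to it. Therefore the arc colouring can be recovered from the edge colouring, and this is a
  bijection onto the proper edge 3-colourings (\<open>card_splitting_boundary_colourings\<close>).
\<close>

section \<open>Evaluating Omega as a count of boundary colourings\<close>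

lemma eval_wxyzt_simps [simp]:
  "eval_wxyzt (p * q) w x y z t = eval_wxyzt p w x y z t * eval_wxyzt q w x y z t"
  "eval_wxyzt (p ^ n) w x y z t = eval_wxyzt p w x y z t ^ n"
  "eval_wxyzt (sum f A) w x y z t = (\<Sum>a\<in>A. eval_wxyzt (f a) w x y z t)"
  "eval_wxyzt (prod f A) w x y z t = (\<Prod>a\<in>A. eval_wxyzt (f a) w x y z t)"
  by (simp_all add: eval_wxyzt_def poly_sum poly_prod poly_power)

lemma eval_wxyzt_vars [simp]:
  "eval_wxyzt var_w w x y z t = w" "eval_wxyzt var_x w x y z t = x"
  "eval_wxyzt var_y w x y z t = y" "eval_wxyzt var_z w x y z t = z"
  "eval_wxyzt var_t w x y z t = t"
  by (simp_all add: eval_wxyzt_def var_w_def var_x_def var_y_def var_z_def var_t_def)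

definition constant_along :: "('a \<Rightarrow> 'c) \<Rightarrow> ('a \<times> 'a) set \<Rightarrow> bool" where
  "constant_along \<phi> R \<longleftrightarrow> (\<forall>(u, v)\<in>R. \<phi> u = \<phi> v)"

lemma constant_along_simps:
  "constant_along \<phi> (R \<union> S) \<longleftrightarrow> constant_along \<phi> R \<and> constant_along \<phi> S"
  "constant_along \<phi> (\<Union>i\<in>I. T i) \<longleftrightarrow> (\<forall>i\<in>I. constant_along \<phi> (T i))"
  "constant_along \<phi> (graph_on F h) \<longleftrightarrow> (\<forall>f\<in>F. \<phi> (h f) = \<phi> f)"
  by (auto simp: constant_along_def graph_on_def)

lemma constant_along_rtrancl:
  assumes "constant_along \<phi> R" and "(u, v) \<in> R\<^sup>*"
  shows "\<phi> u = \<phi> v"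
  using assms(2,1) by induction (auto simp: constant_along_def)

text \<open>
  A map constant along \<open>R\<close> is a map on the classes of \<open>R\<^sup>*\<close>. This turns the powers of \<open>t\<close> in the state
  sum into colourings with \<open>t\<close> colours.
\<close>

lemma card_colourings_constant_along:
  assumes "finite F" and sym: "sym R" and R: "R \<subseteq> F \<times> F"
  shows "card {\<phi> \<in> F \<rightarrow>\<^sub>E (C :: 'c set). constant_along \<phi> R} = card C ^ card (F // R\<^sup>*)"
proof -
  have equiv: "equiv UNIV (R\<^sup>*)"
    using sym by (auto simp: equiv_def refl_on_def sym_rtrancl trans_rtrancl)
  have same: "R\<^sup>* `` {u} = R\<^sup>* `` {v}" if "(u, v) \<in> R" for u v
    using equiv_class_eq[OF equiv] that by blast
  let ?to = "\<lambda>\<psi>. \<lambda>u\<in>F. \<psi> (R\<^sup>* `` {u})"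
  let ?from = "\<lambda>\<phi>. \<lambda>K\<in>F // R\<^sup>*. \<phi> (SOME u. u \<in> F \<and> K = R\<^sup>* `` {u})"
  have rep: "(SOME u. u \<in> F \<and> K = R\<^sup>* `` {u}) \<in> F \<and> K = R\<^sup>* `` {SOME u. u \<in> F \<and> K = R\<^sup>* `` {u}}"
    if "K \<in> F // R\<^sup>*" for K
    using someI_ex[of "\<lambda>u. u \<in> F \<and> K = R\<^sup>* `` {u}"] that by (auto elim!: quotientE)
  have "bij_betw ?to ((F // R\<^sup>*) \<rightarrow>\<^sub>E C) {\<phi> \<in> F \<rightarrow>\<^sub>E C. constant_along \<phi> R}"
  proof (rule bij_betw_byWitness[where f' = ?from])
    show "\<forall>\<psi>\<in>F // R\<^sup>* \<rightarrow>\<^sub>E C. ?from (?to \<psi>) = \<psi>"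
      using rep by (auto intro!: ext simp: PiE_def extensional_def)
    show "\<forall>\<phi>\<in>{\<phi> \<in> F \<rightarrow>\<^sub>E C. constant_along \<phi> R}. ?to (?from \<phi>) = \<phi>"
    proof
      fix \<phi> assume \<phi>: "\<phi> \<in> {\<phi> \<in> F \<rightarrow>\<^sub>E C. constant_along \<phi> R}"
      have "?to (?from \<phi>) u = \<phi> u" for u
      proof (cases "u \<in> F")
        case True
        then have K: "R\<^sup>* `` {u} \<in> F // R\<^sup>*" by (rule quotientI)
        then have "(SOME v. v \<in> F \<and> R\<^sup>* `` {u} = R\<^sup>* `` {v}, u) \<in> R\<^sup>*" using rep[OF K] by blast
        then show ?thesis using constant_along_rtrancl \<phi> True K by fastforce
      qed (use \<phi> in \<open>auto simp: PiE_def extensional_def\<close>)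
      then show "?to (?from \<phi>) = \<phi>" ..
    qed
    show "?to ` (F // R\<^sup>* \<rightarrow>\<^sub>E C) \<subseteq> {\<phi> \<in> F \<rightarrow>\<^sub>E C. constant_along \<phi> R}"
    proof -
      have "?to \<psi> u = ?to \<psi> v" if "(u, v) \<in> R" for \<psi> :: "'a set \<Rightarrow> 'c" and u v
        using same[OF that] that R by auto
      then show ?thesis by (fastforce simp: constant_along_def PiE_iff quotientI)
    qed
    show "?from ` {\<phi> \<in> F \<rightarrow>\<^sub>E C. constant_along \<phi> R} \<subseteq> F // R\<^sup>* \<rightarrow>\<^sub>E C"
      using rep by (auto simp: PiE_iff)
  qed
  then have "card {\<phi> \<in> F \<rightarrow>\<^sub>E C. constant_along \<phi> R} = card ((F // R\<^sup>*) \<rightarrow>\<^sub>E C)"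
    by (simp add: bij_betw_same_card)
  also have "finite (F // R\<^sup>*)" using \<open>finite F\<close> by (simp add: quotient_def)
  then have "card ((F // R\<^sup>*) \<rightarrow>\<^sub>E C) = card C ^ card (F // R\<^sup>*)" by (rule card_funcsetE)
  finally show ?thesis .
qed

text \<open>
  A colour at each corner, the same at both end points of every arc, is a colour on each arc of a
  vertex.
\<close>

definition boundary_colourings :: "('a, 'b) ribbon_scheme \<Rightarrow> 'c set \<Rightarrow> ('a \<Rightarrow> 'c) set" where
  "boundary_colourings G C = {\<phi> \<in> corners G \<rightarrow>\<^sub>E C. \<forall>f\<in>corners G. \<phi> (arc G f) = \<phi> f}"

definition step_weight :: "int \<Rightarrow> int \<Rightarrow> int \<Rightarrow> int \<Rightarrow> nat \<Rightarrow> int" where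
  "step_weight w x y z k = (if k = 0 then w else if k = 1 then x else if k = 2 then y else z)"

lemma eval_state_weight [simp]:
  "eval_wxyzt (state_weight k) w x y z t = step_weight w x y z k"
  by (simp add: state_weight_def step_weight_def)

text \<open>
  Each power of \<open>t\<close> is a number of colourings constant along the arcs and along the steps of the state.
  The arcs do not depend on the state, and the remaining condition is a conjunction over the edges,
  so after the two sums are exchanged the sum over states factors. An isolated vertex is a
  component without corners, which any colour fits.
\<close>

lemma eval_Omega_boundary_colourings:
  assumes G: "ribbon_graph G" and dark: "dark G = {}" and C: "finite C"
  shows "eval_wxyzt (Omega G) w x y z (int (card C)) = int (card C) ^ isolated G *
    (\<Sum>\<phi>\<in>boundary_colourings G C. \<Prod>e\<in>edges G.
       \<Sum>k\<in>{0..<4}. step_weight w x y z k * of_bool (constant_along \<phi> (state_steps G k e)))"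
proof -
  let ?F = "corners G" and ?E = "edges G" and ?B = "boundary_colourings G C"
  let ?S = "?E \<rightarrow>\<^sub>E {0..<4::nat}" and ?W = "step_weight w x y z"
  note fin = ribbon_graphD(1)[OF G] finite_edges[OF G]
  have finB: "finite ?B" using fin C by (simp add: boundary_colourings_def finite_PiE)
  have epG: "edge_point_ribbon_graph G" and light: "light_edges G = ?E"
    using G dark by (auto simp: edge_point_ribbon_graph_def light_edges_def)
  have kappa: "int (card C) ^ state_kappa G \<sigma> = int (card C) ^ isolated G *
      (\<Sum>\<phi>\<in>?B. \<Prod>e\<in>?E. of_bool (constant_along \<phi> (state_steps G (\<sigma> e) e)))" for \<sigma>
  proof -
    have steps: "states_steps G \<sigma> ?E = (\<Union>e\<in>?E. state_steps G (\<sigma> e) e)"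
      using dark by (simp add: states_steps_def)
    have "sym (state_rel G \<sigma>)" unfolding state_rel_def
      using sym_graph_on[OF ribbon_graphD(4)[OF G]] sym_states_steps[OF G order_refl] by (rule sym_Un)
    moreover have "state_rel G \<sigma> \<subseteq> ?F \<times> ?F"
    proof -
      have "graph_on ?F (arc G) \<subseteq> ?F \<times> ?F"
        using pairing_onD(1)[OF ribbon_graphD(4)[OF G]] by (auto simp: graph_on_iff)
      moreover have "\<Union>?E \<subseteq> ?F" using edge_facts(1)[OF G] by blast
      ultimately show ?thesis
        using states_steps_subset[OF G order_refl, of \<sigma>] unfolding state_rel_def by blast
    qed
    ultimately have "card C ^ card (?F // (state_rel G \<sigma>)\<^sup>*)
        = card {\<phi> \<in> ?F \<rightarrow>\<^sub>E C. constant_along \<phi> (state_rel G \<sigma>)}"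
      by (rule card_colourings_constant_along[OF fin(1), symmetric])
    also have "{\<phi> \<in> ?F \<rightarrow>\<^sub>E C. constant_along \<phi> (state_rel G \<sigma>)}
        = {\<phi> \<in> ?B. \<forall>e\<in>?E. constant_along \<phi> (state_steps G (\<sigma> e) e)}"
      by (auto simp: boundary_colourings_def state_rel_def steps constant_along_simps)
    also have "int (card \<dots>) = (\<Sum>\<phi>\<in>?B. of_bool (\<forall>e\<in>?E. constant_along \<phi> (state_steps G (\<sigma> e) e)))"
      using finB by (simp add: sum.If_cases of_bool_def Int_def)
    also have "\<dots> = (\<Sum>\<phi>\<in>?B. \<Prod>e\<in>?E. of_bool (constant_along \<phi> (state_steps G (\<sigma> e) e)))"
      using fin(2) by (intro sum.cong refl) (auto simp: of_bool_def)
    finally show ?thesis by (simp add: state_kappa_def power_add)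
  qed
  have "eval_wxyzt (Omega G) w x y z (int (card C))
      = (\<Sum>\<sigma>\<in>?S. (\<Prod>e\<in>?E. ?W (\<sigma> e)) * int (card C) ^ state_kappa G \<sigma>)"
    by (simp add: Omega_eq_state_sum[OF epG] state_sum_def light)
  also have "\<dots> = int (card C) ^ isolated G * (\<Sum>\<sigma>\<in>?S. \<Sum>\<phi>\<in>?B. \<Prod>e\<in>?E.
      ?W (\<sigma> e) * of_bool (constant_along \<phi> (state_steps G (\<sigma> e) e)))"
    by (simp add: kappa sum_distrib_left prod.distrib mult_ac)
  also have "\<dots> = int (card C) ^ isolated G * (\<Sum>\<phi>\<in>?B. \<Sum>\<sigma>\<in>?S. \<Prod>e\<in>?E.
      ?W (\<sigma> e) * of_bool (constant_along \<phi> (state_steps G (\<sigma> e) e)))"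
    by (simp only: sum.swap[of _ ?S])
  also have "\<dots> = int (card C) ^ isolated G * (\<Sum>\<phi>\<in>?B. \<Prod>e\<in>?E. \<Sum>k\<in>{0..<4}.
      ?W k * of_bool (constant_along \<phi> (state_steps G k e)))"
    by (subst prod_sum_PiE) (use fin(2) in simp_all)
  finally show ?thesis .
qed

text \<open>
  The two ends of an edge that contains \<open>f\<close> are \<open>{f, seg G f}\<close> and \<open>{side G f, seg G (side G f)}\<close>.
  Comparing their colours as sets allows for an edge with or without a half-twist.
\<close>

definition splits_edges :: "('a, 'b) ribbon_scheme \<Rightarrow> ('a \<Rightarrow> 'c) \<Rightarrow> 'a set \<Rightarrow> bool" where
  "splits_edges G \<phi> F \<longleftrightarrow> (\<forall>f\<in>F. \<phi> (seg G f) \<noteq> \<phi> f \<and>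
     {\<phi> (side G f), \<phi> (seg G (side G f))} = {\<phi> f, \<phi> (seg G f)})"

text \<open>
  The weight \<open>-2\<close> cancels the monochromatic edges, which contraction and Penrose-contraction both
  admit; at all other edges these two exclude each other.
\<close>

lemma local_weight:
  assumes G: "ribbon_graph G" and e: "e \<in> edges G"
  shows "(\<Sum>k\<in>{0..<4}. step_weight (-2) 1 0 1 k * of_bool (constant_along \<phi> (state_steps G k e)))
    = of_bool (splits_edges G \<phi> e)"
proof -
  obtain f where f: "f \<in> corners G" "e = edge_of G f" using e edges_eq[OF G] by auto
  note c = corner_facts[OF G f(1)]
  let ?s = "seg G f" and ?t = "side G f" and ?u = "side G (seg G f)"
  have e4: "e = {f, ?s, ?t, ?u}" by (simp add: f(2) edge_of_def)
  have "constant_along \<phi> (state_steps G 0 e) \<longleftrightarrow> \<phi> f = \<phi> ?s \<and> \<phi> f = \<phi> ?t \<and> \<phi> f = \<phi> ?u"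
    unfolding constant_along_def state_steps_def e4 by auto
  moreover have "constant_along \<phi> (state_steps G 1 e) \<longleftrightarrow> \<phi> f = \<phi> ?t \<and> \<phi> ?s = \<phi> ?u"
    unfolding constant_along_def state_steps_def graph_on_def state_pairing_def e4 using c by auto
  moreover have "constant_along \<phi> (state_steps G 3 e) \<longleftrightarrow> \<phi> f = \<phi> ?u \<and> \<phi> ?s = \<phi> ?t"
    unfolding constant_along_def state_steps_def graph_on_def state_pairing_def e4 using c by auto
  moreover have "splits_edges G \<phi> e \<longleftrightarrow> \<phi> f \<noteq> \<phi> ?s \<and> {\<phi> ?t, \<phi> ?u} = {\<phi> f, \<phi> ?s}"
    unfolding splits_edges_def e4 using c by (auto simp: doubleton_eq_iff)
  ultimately show ?thesis
    unfolding sum_0_4 by (auto simp: step_weight_def of_bool_def doubleton_eq_iff)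
qed

lemma eval_Omega_splitting:
  fixes G :: "'a edge_point_ribbon" and C :: "'c set"
  assumes G: "ribbon_graph G" and dark: "dark G = {}" and C: "finite C"
  shows "eval_wxyzt (Omega G) (-2) 1 0 1 (int (card C)) = int (card C) ^ isolated G *
    int (card {\<phi> \<in> boundary_colourings G C. splits_edges G \<phi> (corners G)})"
proof -
  have U: "corners G = \<Union>(edges G)"
    using edge_facts(1)[OF G] edges_eq[OF G] by (auto simp: edge_of_def)
  have "finite (boundary_colourings G C)"
    using ribbon_graphD(1)[OF G] C by (simp add: boundary_colourings_def finite_PiE)
  moreover have "(\<Prod>e\<in>edges G. of_bool (splits_edges G \<phi> e))
      = (of_bool (splits_edges G \<phi> (corners G)) :: int)"
    for \<phi> :: "'a \<Rightarrow> 'c"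
  proof -
    have "splits_edges G \<phi> (corners G) \<longleftrightarrow> (\<forall>e\<in>edges G. splits_edges G \<phi> e)"
      unfolding splits_edges_def U by blast
    then show ?thesis using finite_edges[OF G] by (auto simp: of_bool_def)
  qed
  moreover have "eval_wxyzt (Omega G) (-2) 1 0 1 (int (card C)) = int (card C) ^ isolated G *
      (\<Sum>\<phi>\<in>boundary_colourings G C. \<Prod>e\<in>edges G. of_bool (splits_edges G \<phi> e))"
    unfolding eval_Omega_boundary_colourings[OF assms]
    by (intro arg_cong2[where f = "(*)"] refl sum.cong prod.cong local_weight[OF G])
  ultimately show ?thesis by (simp only: of_bool_def) (simp add: sum.If_cases Int_def)
qed

section \<open>Cubic vertices\<close>

lemma conn_subset:
  assumes "f \<in> S" and "\<And>g h. g \<in> S \<Longrightarrow> h \<in> hs \<Longrightarrow> h g \<in> S"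
  shows "conn hs A `` {f} \<subseteq> S"
proof
  fix g assume "g \<in> conn hs A `` {f}"
  then have "(f, g) \<in> {(x, h x) | x h. x \<in> A \<and> h \<in> hs}\<^sup>*" by (simp add: conn_def)
  then show "g \<in> S" using assms(1) by (rule rtrancl_closed) (use assms(2) in auto)
qed

lemma vertex_of_corner:
  assumes G: "ribbon_graph G" and v: "v \<in> vertices G" and f: "f \<in> v"
  shows "f \<in> corners G" "v = conn {seg G, arc G} (corners G) `` {f}"
proof -
  let ?R = "{(x, h x) | x h. x \<in> corners G \<and> h \<in> {seg G, arc G}}"
  obtain x where x: "x \<in> corners G" "v = ?R\<^sup>* `` {x}"
    using v by (auto simp: vertices_def orbits_def conn_def elim: quotientE)
  note p = pairing_onD[OF ribbon_graphD(2)[OF G]] pairing_onD[OF ribbon_graphD(4)[OF G]]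
  have "?R = graph_on (corners G) (seg G) \<union> graph_on (corners G) (arc G)"
    by (auto simp: graph_on_def)
  then have "sym ?R"
    using sym_Un[OF sym_graph_on sym_graph_on] ribbon_graphD(2,4)[OF G] by metis
  then have "equiv UNIV (?R\<^sup>*)" by (auto simp: equiv_def refl_on_def sym_rtrancl trans_rtrancl)
  moreover have "(x, f) \<in> ?R\<^sup>*" using f x by auto
  ultimately show "v = conn {seg G, arc G} (corners G) `` {f}"
    unfolding conn_def x(2) by (rule equiv_class_eq)
  show "f \<in> corners G"
    using \<open>(x, f) \<in> ?R\<^sup>*\<close> x(1) by (rule rtrancl_closed) (use p in auto)
qed

lemma edge_ends_eq:
  assumes G: "ribbon_graph G"
  shows "edge_ends G = (\<lambda>f. {f, seg G f}) ` corners G"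
proof -
  have "conn {seg G} (corners G) `` {f} = {f, seg G f}" if f: "f \<in> corners G" for f
  proof
    show "conn {seg G} (corners G) `` {f} \<subseteq> {f, seg G f}"
      by (rule conn_subset) (use corner_facts(3)[OF G f] in auto)
    show "{f, seg G f} \<subseteq> conn {seg G} (corners G) `` {f}" using f by (auto simp: conn_def)
  qed
  then show ?thesis by (auto simp: edge_ends_def orbits_def quotient_def)
qed

text \<open>
  The boundary of a cubic vertex is a hexagon alternating between ends and arcs. \<open>A\<close> is the end at
  \<open>f\<close>, and \<open>B\<close> and \<open>C\<close> are reached from it along the arcs at its two corners. If two of
  them coincided, the boundary would close up after fewer than three ends. As there are only three
  ends, the arc that leaves \<open>B\<close> at its other corner must arrive at the free corner of \<open>C\<close>.
\<close>

lemma cubic_vertex: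
  assumes G: "ribbon_graph G" and cubic: "cubic G" and f: "f \<in> corners G"
    and v: "v = conn {seg G, arc G} (corners G) `` {f}"
  defines "A \<equiv> {f, seg G f}" and "B \<equiv> {arc G f, seg G (arc G f)}"
    and "C \<equiv> {arc G (seg G f), seg G (arc G (seg G f))}"
  shows "v \<in> vertices G" "{s \<in> edge_ends G. s \<subseteq> v} = {A, B, C}" "A \<noteq> B" "A \<noteq> C" "B \<noteq> C"
    "arc G (seg G (arc G f)) = seg G (arc G (seg G f))"
proof -
  define s a where "s = seg G" and "a = arc G"
  note p = pairing_onD[OF ribbon_graphD(2)[OF G], folded s_def]
    pairing_onD[OF ribbon_graphD(4)[OF G], folded a_def]
  have cl: "s f \<in> corners G" "a f \<in> corners G" "s (a f) \<in> corners G" "a (s f) \<in> corners G"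
    "s (a (s f)) \<in> corners G" "a (s (a f)) \<in> corners G"
    using f p by simp_all
  show vert: "v \<in> vertices G" unfolding v vertices_def orbits_def by (rule quotientI[OF f])
  have step: "s g \<in> v" "a g \<in> v" if "g \<in> v" "g \<in> corners G" for g
    using that unfolding v conn_def s_def a_def by (auto intro: rtrancl_into_rtrancl)
  have fv: "f \<in> v" by (simp add: v conn_def)
  let ?ends = "{t \<in> edge_ends G. t \<subseteq> v}"
  have ends: "?ends = (\<lambda>g. {g, s g}) ` v"
    using step vertex_of_corner(1)[OF G vert] unfolding edge_ends_eq[OF G] s_def by auto
  have card: "card ?ends = 3" using cubic vert by (simp add: cubic_def degree_of_def)
  have ABC: "A = {f, s f}" "B = {a f, s (a f)}" "C = {a (s f), s (a (s f))}"
    by (simp_all add: A_def B_def C_def s_def a_def)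
  have sub: "v \<subseteq> S" if "f \<in> S" "\<And>g. g \<in> S \<Longrightarrow> s g \<in> S \<and> a g \<in> S" for S
    unfolding v by (rule conn_subset) (use that in \<open>auto simp: s_def a_def\<close>)
  have "a f \<noteq> s f"
  proof
    assume eq: "a f = s f"
    then have "a (s f) = f" using p f by metis
    then have "v \<subseteq> A" unfolding ABC by (intro sub) (use eq p f in auto)
    then have "?ends \<subseteq> {A}" unfolding ends ABC using p(2)[OF f] by auto
    then show False using card card_mono[of "{A}" ?ends] by simp
  qed
  then have ne: "a f \<noteq> f" "a f \<noteq> s f" "a (s f) \<noteq> s f" "a (s f) \<noteq> f" "a (s f) \<noteq> a f"
    using p f cl by metis+
  have "a (s f) \<noteq> s (a f)"
  proof
    assume eq: "a (s f) = s (a f)"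
    then have "a (s (a f)) = s f" using p cl by metis
    then have "v \<subseteq> A \<union> B" unfolding ABC by (intro sub) (use eq p f cl in auto)
    then have "?ends \<subseteq> {A, B}" unfolding ends ABC using p(2)[OF f] p(2)[OF cl(2)] by auto
    then have "card ?ends \<le> card {A, B}" by (intro card_mono) auto
    also have "\<dots> \<le> 2" by (simp add: card_insert_if)
    finally show False using card by simp
  qed
  note ne = ne this
  show AB: "A \<noteq> B" and AC: "A \<noteq> C" and BC: "B \<noteq> C"
  proof -
    have "a f \<in> B" "a (s f) \<in> C" "a f \<notin> A" "a (s f) \<notin> A" "a (s f) \<notin> B"
      using ne unfolding ABC by auto
    then show "A \<noteq> B" "A \<noteq> C" "B \<noteq> C" by auto
  qed
  have "f \<in> v" "a f \<in> v" "a (s f) \<in> v" using fv step f cl by simp_all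
  then have "{A, B, C} \<subseteq> ?ends" unfolding ends ABC by blast
  moreover have "card {A, B, C} = card ?ends" using AB AC BC card by simp
  moreover have "finite ?ends" using card by (intro card_ge_0_finite) simp
  ultimately show all: "?ends = {A, B, C}" using card_subset_eq[of ?ends "{A, B, C}"] by simp
  let ?p = "a (s (a f))"
  have "?p \<in> v" using fv step f cl by simp
  then have "{?p, s ?p} \<in> ?ends" unfolding ends by (rule imageI)
  then have "{?p, s ?p} \<in> {A, B, C}" unfolding all .
  then have "?p \<in> A \<union> B \<union> C" by auto
  moreover have prev: "s (a f) = a x" if "?p = x" for x using p(5)[OF cl(3)] that by simp
  have "s (a f) \<noteq> f" "s (a f) \<noteq> s f" using ne(1,2) p(2)[OF cl(2)] p(2)[OF f] by metis+
  then have "?p \<noteq> a f" "?p \<noteq> a (s f)" using prev p(5)[OF f] p(5)[OF cl(1)] by metis+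
  moreover have "?p \<noteq> f" "?p \<noteq> s f" "?p \<noteq> s (a f)"
    using prev[of f] prev[of "s f"] p(3)[OF cl(2)] ne(6) p(6)[OF cl(3)] by metis+
  ultimately have "?p = s (a (s f))" unfolding ABC by blast
  then show "arc G (seg G (arc G f)) = seg G (arc G (seg G f))"
    by (simp add: s_def a_def)
qed

lemma edge_of_eq:
  assumes G: "ribbon_graph G" and f: "f \<in> corners G"
  shows "edge_of G f \<in> edges G" "edge_of G (seg G f) = edge_of G f" "edge_of G (side G f) = edge_of G f"
proof -
  show "edge_of G f \<in> edges G" unfolding edges_eq[OF G] using f by (rule imageI)
  show "edge_of G (seg G f) = edge_of G f" "edge_of G (side G f) = edge_of G f"
    by (rule edge_of_closed(4)[OF G f]; simp add: edge_of_def)+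
qed

text \<open>
  Any two of three ends on a circle are joined by an arc, so properness only needs to be tested
  along the arcs.
\<close>

lemma cubic_proper_edge_3_colouring_iff:
  assumes G: "ribbon_graph G" and cubic: "cubic G"
  shows "proper_edge_3_colouring G c \<longleftrightarrow> c \<in> edges G \<rightarrow>\<^sub>E {1, 2, 3} \<and>
    (\<forall>f\<in>corners G. c (edge_of G f) \<noteq> c (edge_of G (arc G f)))"
proof
  assume c: "proper_edge_3_colouring G c"
  have differ: "c e \<noteq> c e'"
    if "v \<in> vertices G" "s \<in> edge_ends G" "s' \<in> edge_ends G" "s \<subseteq> v" "s' \<subseteq> v" "s \<noteq> s'"
      "e \<in> edges G" "e' \<in> edges G" "s \<subseteq> e" "s' \<subseteq> e'" for v s s' e e'
    using c that unfolding proper_edge_3_colouring_def by blast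
  have "c (edge_of G f) \<noteq> c (edge_of G (arc G f))" if f: "f \<in> corners G" for f
  proof -
    note V = cubic_vertex[OF G cubic f refl]
    have af: "arc G f \<in> corners G" using pairing_onD(1)[OF ribbon_graphD(4)[OF G] f] .
    let ?v = "conn {seg G, arc G} (corners G) `` {f}"
    have "{f, seg G f} \<in> {s \<in> edge_ends G. s \<subseteq> ?v}"
      "{arc G f, seg G (arc G f)} \<in> {s \<in> edge_ends G. s \<subseteq> ?v}"
      unfolding V(2) by simp_all
    then have ends: "{f, seg G f} \<in> edge_ends G" "{arc G f, seg G (arc G f)} \<in> edge_ends G"
      "{f, seg G f} \<subseteq> ?v" "{arc G f, seg G (arc G f)} \<subseteq> ?v" by simp_all
    show ?thesis
      by (rule differ[OF V(1) ends V(3) edge_of_eq(1)[OF G f] edge_of_eq(1)[OF G af]])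
        (simp_all add: edge_of_def)
  qed
  then show "c \<in> edges G \<rightarrow>\<^sub>E {1, 2, 3} \<and> (\<forall>f\<in>corners G. c (edge_of G f) \<noteq> c (edge_of G (arc G f)))"
    using c by (simp add: proper_edge_3_colouring_def)
next
  assume c: "c \<in> edges G \<rightarrow>\<^sub>E {1, 2, 3} \<and> (\<forall>f\<in>corners G. c (edge_of G f) \<noteq> c (edge_of G (arc G f)))"
  have "c e \<noteq> c e'"
    if v: "v \<in> vertices G" and s: "s \<in> edge_ends G" "s' \<in> edge_ends G" "s \<subseteq> v" "s' \<subseteq> v" "s \<noteq> s'"
      and e: "e \<in> edges G" "e' \<in> edges G" "s \<subseteq> e" "s' \<subseteq> e'" for v s s' e e'
  proof -
    obtain f where f: "f \<in> corners G" "s = {f, seg G f}" using s(1) edge_ends_eq[OF G] by auto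
    have veq: "v = conn {seg G, arc G} (corners G) `` {f}"
      using vertex_of_corner(2)[OF G v] s(3) f(2) by auto
    have sf: "seg G f \<in> corners G" using corner_facts(1)[OF G f(1)] .
    have ef: "e = edge_of G f" using edge_facts(6)[OF G e(1)] e(3) f(2) by auto
    have "s' \<in> {t \<in> edge_ends G. t \<subseteq> v}" using s by simp
    then have "arc G f \<in> s' \<or> arc G (seg G f) \<in> s'"
      using s(5) f(2) unfolding cubic_vertex(2)[OF G cubic f(1) veq] by auto
    then have "e' = edge_of G (arc G f) \<or> e' = edge_of G (arc G (seg G f))"
      using edge_facts(6)[OF G e(2)] e(4) by auto
    then show ?thesis
      using c f(1) sf edge_of_eq(2)[OF G f(1)] unfolding ef by metis
  qed
  then show "proper_edge_3_colouring G c"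
    using c unfolding proper_edge_3_colouring_def by blast
qed

section \<open>Boundary colourings and edge colourings\<close>

text \<open>The colours 1, 2 and 3 have sum 6, so \<open>6 - a - b\<close> is the colour other than \<open>a\<close> and \<open>b\<close>.\<close>

lemma third_colour:
  assumes "a \<in> {1, 2, 3::nat}" "b \<in> {1, 2, 3}" "c \<in> {1, 2, 3}" "a \<noteq> b" "a \<noteq> c" "b \<noteq> c"
  shows "6 - a - b = c" "6 - a - c = b" "6 - c - b = a"
  using assms by auto

lemma third_colour_range:
  assumes "a \<in> {1, 2, 3::nat}" "b \<in> {1, 2, 3}" "a \<noteq> b"
  shows "6 - a - b \<in> {1, 2, 3}"
  using assms by auto

text \<open>
  An edge colouring gives an arc the colour missing at its two adjacent ends, which is the colour of
  the opposite end; an arc colouring gives an edge the colour missing at its two corners on either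
  end. At a cubic vertex these two rules undo each other.
\<close>

lemma card_splitting_boundary_colourings:
  assumes G: "ribbon_graph G" and cubic: "cubic G"
  shows "card {\<phi> \<in> boundary_colourings G {1, 2, 3::nat}. splits_edges G \<phi> (corners G)}
    = card {c. proper_edge_3_colouring G c}"
proof -
  let ?B = "{\<phi> \<in> boundary_colourings G {1, 2, 3::nat}. splits_edges G \<phi> (corners G)}"
  let ?P = "{c. proper_edge_3_colouring G c}"
  let ?opp = "\<lambda>c. \<lambda>f\<in>corners G. 6 - c (edge_of G f) - c (edge_of G (arc G f))"
  \<comment> \<open>Colours of the ends at \<open>f\<close>, next to \<open>f\<close>, and opposite to the arc of \<open>f\<close>.\<close>
  let ?a = "\<lambda>c f. c (edge_of G f)" and ?b = "\<lambda>c f. c (edge_of G (arc G f))"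
    and ?c = "\<lambda>c f. c (edge_of G (arc G (seg G f)))"
  let ?missing = "\<lambda>\<phi> f. 6 - \<phi> f - \<phi> (seg G f)"
  let ?third = "\<lambda>\<phi>. \<lambda>e\<in>edges G. ?missing \<phi> (SOME f. f \<in> e)"
  note p = pairing_onD[OF ribbon_graphD(2)[OF G]] pairing_onD[OF ribbon_graphD(4)[OF G]]
  have hexagon: "arc G (seg G (arc G f)) = seg G (arc G (seg G f))" if "f \<in> corners G" for f
    using cubic_vertex(6)[OF G cubic that refl] .
  have edge_nonempty: "(SOME f. f \<in> e) \<in> e \<and> (SOME f. f \<in> e) \<in> corners G" if "e \<in> edges G" for e
  proof -
    have "\<exists>f. f \<in> e" using that unfolding edges_eq[OF G] edge_of_def by auto
    then have "(SOME f. f \<in> e) \<in> e" by (rule someI_ex)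
    then show ?thesis using edge_facts(1)[OF G that] by auto
  qed
  have proper: "c \<in> edges G \<rightarrow>\<^sub>E {1, 2, 3} \<and>
      (\<forall>f\<in>corners G. c (edge_of G f) \<noteq> c (edge_of G (arc G f)))" if "c \<in> ?P" for c
    using that cubic_proper_edge_3_colouring_iff[OF G cubic] by simp
  have three: "?a c f \<in> {1, 2, 3}" "?b c f \<in> {1, 2, 3}" "?c c f \<in> {1, 2, 3}"
      "?a c f \<noteq> ?b c f" "?a c f \<noteq> ?c c f" "?b c f \<noteq> ?c c f"
    if c: "c \<in> ?P" and f: "f \<in> corners G" for c f
  proof -
    have in3: "c (edge_of G g) \<in> {1, 2, 3}" if "g \<in> corners G" for g
      using proper[OF c] edge_of_eq(1)[OF G that] by (auto simp: PiE_iff)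
    have cl: "seg G f \<in> corners G" "arc G f \<in> corners G" "arc G (seg G f) \<in> corners G"
      "seg G (arc G f) \<in> corners G" using f p by simp_all
    have ne: "c (edge_of G g) \<noteq> c (edge_of G (arc G g))" if "g \<in> corners G" for g
      using proper[OF c] that by blast
    show "?a c f \<in> {1, 2, 3}" "?b c f \<in> {1, 2, 3}" "?c c f \<in> {1, 2, 3}"
      by (intro in3 f cl)+
    show "?a c f \<noteq> ?b c f" "?a c f \<noteq> ?c c f" "?b c f \<noteq> ?c c f"
      using ne[OF f] ne[OF cl(1)] ne[OF cl(4)] by (simp_all add: hexagon f cl edge_of_eq(2)[OF G])
  qed
  have opp: "?opp c f = ?c c f" "?opp c (seg G f) = ?b c f" if c: "c \<in> ?P" and f: "f \<in> corners G" for c f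
    using third_colour(1,2)[OF three[OF c f]] f p(1)[OF f] by (simp_all add: edge_of_eq(2)[OF G f])
  have bd: "\<phi> \<in> corners G \<rightarrow>\<^sub>E {1, 2, 3}" "\<And>f. f \<in> corners G \<Longrightarrow> \<phi> f \<in> {1, 2, 3}"
      "\<And>f. f \<in> corners G \<Longrightarrow> \<phi> (arc G f) = \<phi> f"
      "\<And>f. f \<in> corners G \<Longrightarrow> \<phi> (seg G f) \<noteq> \<phi> f"
      "\<And>f. f \<in> corners G \<Longrightarrow> {\<phi> (side G f), \<phi> (seg G (side G f))} = {\<phi> f, \<phi> (seg G f)}"
    if "\<phi> \<in> ?B" for \<phi>
    using that by (auto simp: boundary_colourings_def splits_edges_def PiE_iff)
  have third: "?third \<phi> (edge_of G f) = ?missing \<phi> f" if \<phi>: "\<phi> \<in> ?B" and f: "f \<in> corners G" for \<phi> f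
  proof -
    \<comment> \<open>All four corners of an edge miss the same colour, so the choice of a corner is immaterial.\<close>
    have "?missing \<phi> g = ?missing \<phi> f" if "g \<in> edge_of G f" for g
    proof -
      have "\<phi> (side G f) + \<phi> (seg G (side G f)) = \<phi> f + \<phi> (seg G f)"
        using bd(5)[OF \<phi> f] by (auto simp: doubleton_eq_iff)
      then show ?thesis
        using that corner_facts[OF G f] by (auto simp: edge_of_def)
    qed
    then show ?thesis using edge_nonempty[OF edge_of_eq(1)[OF G f]] edge_of_eq(1)[OF G f] by simp
  qed
  have around: "\<phi> (seg G (arc G f)) \<in> {1, 2, 3} \<and> \<phi> (seg G f) \<in> {1, 2, 3} \<and> \<phi> f \<in> {1, 2, 3} \<and>
      \<phi> (seg G (arc G f)) \<noteq> \<phi> f \<and> \<phi> (seg G f) \<noteq> \<phi> f \<and> \<phi> (seg G (arc G f)) \<noteq> \<phi> (seg G f)"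
    if \<phi>: "\<phi> \<in> ?B" and f: "f \<in> corners G" for \<phi> f
  proof -
    have cl: "seg G f \<in> corners G" "arc G f \<in> corners G" "arc G (seg G f) \<in> corners G"
      "seg G (arc G f) \<in> corners G" using f p by simp_all
    \<comment> \<open>The other two arcs of the vertex enclose its third end, so their colours differ too.\<close>
    have "\<phi> (seg G (arc G f)) = \<phi> (seg G (arc G (seg G f)))"
      using bd(3)[OF \<phi> cl(4)] hexagon[OF f] by simp
    moreover have "\<phi> (seg G f) = \<phi> (arc G (seg G f))" using bd(3)[OF \<phi> cl(1)] by simp
    ultimately have "\<phi> (seg G (arc G f)) \<noteq> \<phi> (seg G f)" using bd(4)[OF \<phi> cl(3)] by simp
    moreover have "\<phi> (seg G (arc G f)) \<noteq> \<phi> f" using bd(3)[OF \<phi> f] bd(4)[OF \<phi> cl(2)] by simp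
    ultimately show ?thesis using bd(2,4)[OF \<phi>] f cl by blast
  qed
  have third_arc: "?third \<phi> (edge_of G (arc G f)) = 6 - \<phi> f - \<phi> (seg G (arc G f))"
    if \<phi>: "\<phi> \<in> ?B" and f: "f \<in> corners G" for \<phi> f
    using third[OF \<phi> p(4)[OF f]] bd(3)[OF \<phi> f] by simp
  have "bij_betw ?opp ?P ?B"
  proof (rule bij_betw_byWitness[where f' = ?third])
    show "\<forall>c\<in>?P. ?third (?opp c) = c"
    proof
      fix c assume c: "c \<in> ?P"
      show "?third (?opp c) = c"
      proof
        fix e
        show "?third (?opp c) e = c e"
        proof (cases "e \<in> edges G")
          case True
          define f where "f = (SOME f. f \<in> e)"
          have f: "f \<in> corners G" and e: "e = edge_of G f"
            using edge_nonempty[OF True] edge_facts(6)[OF G True] by (auto simp: f_def)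
          have "?third (?opp c) e = ?missing (?opp c) f" using True by (simp only: f_def restrict_apply')
          also have "\<dots> = ?a c f"
            unfolding opp[OF c f] by (rule third_colour(3)[OF three[OF c f]])
          also have "\<dots> = c e" by (simp only: e[symmetric])
          finally show ?thesis .
        qed (use proper[OF c] in \<open>auto simp: PiE_def extensional_def\<close>)
      qed
    qed
    show "\<forall>\<phi>\<in>?B. ?opp (?third \<phi>) = \<phi>"
    proof
      fix \<phi> assume \<phi>: "\<phi> \<in> ?B"
      show "?opp (?third \<phi>) = \<phi>"
      proof
        fix f
        show "?opp (?third \<phi>) f = \<phi> f"
        proof (cases "f \<in> corners G")
          case True
          have "?opp (?third \<phi>) f = 6 - ?missing \<phi> f - (6 - \<phi> f - \<phi> (seg G (arc G f)))"
            unfolding third[OF \<phi> True, symmetric] third_arc[OF \<phi> True, symmetric] using True by simp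
          also have "\<dots> = \<phi> f"
            using around[OF \<phi> True] by auto
          finally show ?thesis .
        qed (use bd(1)[OF \<phi>] in \<open>auto simp: PiE_def extensional_def\<close>)
      qed
    qed
    show "?opp ` ?P \<subseteq> ?B"
    proof
      fix \<phi> assume "\<phi> \<in> ?opp ` ?P"
      then obtain c where c: "c \<in> ?P" and \<phi>: "\<phi> = ?opp c" by auto
      have val: "\<phi> f = ?c c f" "\<phi> (seg G f) = ?b c f" if "f \<in> corners G" for f
        unfolding \<phi> by (rule opp[OF c that])+
      have range: "\<phi> f \<in> {1, 2, 3}" "\<phi> (seg G f) \<noteq> \<phi> f" if "f \<in> corners G" for f
        unfolding val[OF that] by (rule three[OF c that])+
      have pair: "{\<phi> f, \<phi> (seg G f)} = {1, 2, 3} - {c (edge_of G f)}" if "f \<in> corners G" for f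
        unfolding val[OF that] using three[OF c that] by auto
      have "\<phi> (arc G f) = \<phi> f" if "f \<in> corners G" for f
        using that p(4,5)[OF that] by (simp add: \<phi>)
      moreover have "{\<phi> (side G f), \<phi> (seg G (side G f))} = {\<phi> f, \<phi> (seg G f)}" if "f \<in> corners G" for f
        using pair[OF that] pair[OF corner_facts(2)[OF G that]] edge_of_eq(3)[OF G that] by simp
      moreover have "\<phi> \<in> corners G \<rightarrow>\<^sub>E {1, 2, 3}" using range(1) by (simp add: PiE_iff \<phi>)
      ultimately show "\<phi> \<in> ?B"
        using range(2) by (simp add: boundary_colourings_def splits_edges_def)
    qed
    show "?third ` ?B \<subseteq> ?P"
    proof
      fix c assume "c \<in> ?third ` ?B"
      then obtain \<phi> where \<phi>: "\<phi> \<in> ?B" and c: "c = ?third \<phi>" by auto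
      have val: "c (edge_of G f) = ?missing \<phi> f"
        "c (edge_of G (arc G f)) = 6 - \<phi> f - \<phi> (seg G (arc G f))"
        if "f \<in> corners G" for f unfolding c by (rule third[OF \<phi> that] third_arc[OF \<phi> that])+
      have "c (edge_of G f) \<noteq> c (edge_of G (arc G f))" if f: "f \<in> corners G" for f
        unfolding val[OF f] using around[OF \<phi> f] by auto
      moreover have "c e \<in> {1, 2, 3}" if e: "e \<in> edges G" for e
      proof -
        obtain f where f: "f \<in> corners G" "e = edge_of G f" using e edges_eq[OF G] by auto
        show ?thesis unfolding f(2) val(1)[OF f(1)]
          using around[OF \<phi> f(1)] third_colour_range by metis
      qed
      moreover have "c \<in> extensional (edges G)" unfolding c by simp
      ultimately show "c \<in> ?P"
        by (simp add: cubic_proper_edge_3_colouring_iff[OF G cubic] PiE_iff)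
    qed
  qed
  then show ?thesis by (simp add: bij_betw_same_card)
qed

theorem corollary4p6:
  fixes G :: "'a ribbon"
  assumes "ribbon_graph G" and "cubic G"
  shows "eval_wxyzt (Omega (as_edge_point G)) (-2) 1 0 1 3
       = int (card {c. proper_edge_3_colouring G c})"
proof -
  let ?H = "as_edge_point G" and ?C = "{1, 2, 3::nat}"
  have fields: "corners ?H = corners G" "seg ?H = seg G" "side ?H = side G" "arc ?H = arc G"
    "isolated ?H = isolated G" "dark ?H = {}"
    by (simp_all add: as_edge_point_def)
  have H: "ribbon_graph ?H" using assms(1) by (simp add: ribbon_graph_def fields)
  have "{\<phi> \<in> boundary_colourings ?H ?C. splits_edges ?H \<phi> (corners ?H)}
      = {\<phi> \<in> boundary_colourings G ?C. splits_edges G \<phi> (corners G)}"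
    by (simp only: boundary_colourings_def splits_edges_def fields)
  moreover have "isolated ?H = 0" using assms(2) by (simp add: cubic_def fields)
  ultimately have "eval_wxyzt (Omega ?H) (-2) 1 0 1 (int (card ?C))
      = int (card {\<phi> \<in> boundary_colourings G ?C. splits_edges G \<phi> (corners G)})"
    using eval_Omega_splitting[OF H fields(6), of ?C] by simp
  then show ?thesis
    unfolding card_splitting_boundary_colourings[OF assms] by simp
qed

end
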